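(* Let $D$ be an integral domain with quotient field $K$, let $\mathcal I_f$ be the set of nonzero finitely generated ideals of $D$, and let $\widetilde\Phi:\mathrm{SStar}(D)\to\mathrm{SStar}_{f,sp}(D)$ be the map $\widetilde\Phi(\star):=\widetilde\star$. (1) The set $\{\widetilde U_J:=V_J\cap\mathrm{SStar}_{f,sp}(D)\mid J\in\mathcal I_f\}$ is a subbasis of open and quasi-compact subspaces for $\mathrm{SStar}_{f,sp}(D)$ (with the Zariski topology). (2) If $\mathrm{SStar}(D)$ is endowed with the Zariski topology, $\widetilde\Phi$ is a topological retraction. (3) If $\mathrm{SStar}(D)$ is endowed with the topology generated by the family $\{V_J\mid J\in\mathcal I_f\}$, then $\widetilde\Phi$ is the canonical map onto the Kolmogoroff quotient space of $\mathrm{SStar}(D)$. (4) If $\ast$ is a stable star operation of finite type on $D$, there is exactly one stable semistar operation of finite type $\star$ on $D$ such that $\star|_{\mathbf F(D)}=\ast$. (5) The restriction $\boldsymbol\lambda_f:\mathrm{LS}_f(D)\to\mathrm{SStar}_{f,sp}(D)$ of the map $\boldsymbol\lambda:\mathcal F\mapsto\star_{\mathcal F}$, where $E^{\star_{\mathcal F}}:=\bigcup\{(E:H)\mid H\in\mathcal F\}$, is a homeomorphism between spaces endowed with the Zariski topologies.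
   Context: $\overline{\mathbf F}(D)$, $\mathbf F(D)$, $\mathbf f(D)$ denote respectively the sets of nonzero $D$-submodules of $K$, nonzero fractional ideals of $D$, and nonzero finitely generated fractional ideals of $D$. For $D$-submodules $E,H$ of $K$, $(E:H):=\{x\in K\mid xH\subseteq E\}$. A semistar operation on $D$ is a map $\star:\overline{\mathbf F}(D)\to\overline{\mathbf F}(D)$, $E\mapsto E^\star$, such that for all $0\ne z\in K$ and $E,F\in\overline{\mathbf F}(D)$: $(zE)^\star=zE^\star$; $E\subseteq F\Rightarrow E^\star\subseteq F^\star$; $E\subseteq E^\star$; $(E^\star)^\star=E^\star$. $\mathrm{SStar}(D)$ is the set of all semistar operations; its Zariski topology has as subbasis of open sets the sets $V_E:=\{\star\in\mathrm{SStar}(D)\mid 1\in E^\star\}$, $E\in\overline{\mathbf F}(D)$; subsets carry the subspace topology, also called Zariski. A star operation is a map $\ast:\mathbf F(D)\to\mathbf F(D)$ with the same four properties on $\mathbf F(D)$ and with $D^\ast=D$. A semistar (resp. star) operation is of finite type if $E^\star=\bigcup\{F^\star\mid F\subseteq E,F\in\mathbf f(D)\}$ for all $E$ in $\overline{\mathbf F}(D)$ (resp. $\mathbf F(D)$); it is stable if $(E\cap H)^\star=E^\star\cap H^\star$ for all $E,H$ in $\overline{\mathbf F}(D)$ (resp. $\mathbf F(D)$). A semistar operation is spectral if it is of the form $s_Y$, $E^{s_Y}:=\bigcap\{ED_P\mid P\in Y\}$, for some $Y\subseteq\mathrm{Spec}(D)$ (with $E^{s_\emptyset}:=K$). $\mathrm{SStar}_{f,sp}(D)$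 is the set of spectral semistar operations of finite type; it is known to coincide with the set of stable semistar operations of finite type. For $\star\in\mathrm{SStar}(D)$, $\widetilde\star\in\mathrm{SStar}_{f,sp}(D)$ is defined by $$E^{\widetilde\star}:=\bigcup\{(E:J)\mid J\text{ nonzero finitely generated ideal of }D\text{ with }J^\star=D^\star\}.$$ A topological retraction of a space $X$ onto a subspace $A$ is a continuous map $X\to A$ restricting to the identity on $A$. The Kolmogoroff quotient of a space $X$ is its quotient by the relation of topological indistinguishability (two points are indistinguishable if they belong to exactly the same open sets). A localizing system on $D$ is a nonempty set $\mathcal F$ of nonzero ideals of $D$ such that: (i) if $I\in\mathcal F$ and $J\supseteq I$ is an ideal of $D$, then $J\in\mathcal F$; (ii) if $I\in\mathcal F$ and $J$ is an ideal of $D$ such that $(J:_D iD):=\{d\in D\mid di\in J\}\in\mathcal F$ for each $i\in I$, then $J\in\mathcal F$. It is of finite type if each $I\in\mathcal F$ contains a nonzero finitely generated ideal $J\in\mathcal F$. $\mathrm{LS}(D)$ (resp. $\mathrm{LS}_f(D)$) is the set of localizing systems (resp. of finite type). The Zariski topology on $\mathrm{LS}(D)$ has subbasic open sets $W_I:=\{\mathcal F\in\mathrm{LS}(D)\mid I\in\mathcal F\}$, $I$ an ideal of $D$; $\mathrm{LS}_f(D)$ has the subspace topology. *)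

theory Defs
  imports "HOL-Analysis.Analysis" "HOL-Computational_Algebra.Polynomial_Factorial"
begin

text \<open>
  The integral domain \<open>D\<close> is an arbitrary type \<open>'a\<close> of class \<open>idom\<close>, and its quotient field \<open>K\<close> is the
  library type \<open>'a fract\<close>. As usual \<open>D\<close> is identified with its image in \<open>K\<close>: ideals of \<open>D\<close> are
  \<open>D\<close>-submodules of \<open>K\<close> contained in that image.
\<close>

definition \<D> :: "'a::idom fract set"
  where "\<D> = range to_fract"

global_interpretation K: module "\<lambda>(d::'a::idom) (x::'a fract). to_fract d * x"
  by unfold_locales (simp_all add: algebra_simps)


section \<open>Submodules, ideals and fractional ideals\<close>

definition Fbar :: "'a::idom fract set set"
  where "Fbar = {E. K.subspace E \<and> E \<noteq> {0}}"

definition fractional_ideals :: "'a::idom fract set set"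
  where "fractional_ideals = {E \<in> Fbar. \<exists>d\<in>\<D>. d \<noteq> 0 \<and> (\<lambda>x. d * x) ` E \<subseteq> \<D>}"

definition fin_gen :: "'a::idom fract set \<Rightarrow> bool"
  where "fin_gen E \<longleftrightarrow> (\<exists>G. finite G \<and> E = K.span G)"

definition fg_fractional_ideals :: "'a::idom fract set set"
  where "fg_fractional_ideals = {E \<in> fractional_ideals. fin_gen E}"

definition ideals :: "'a::idom fract set set"
  where "ideals = {I. K.subspace I \<and> I \<subseteq> \<D>}"

definition fg_ideals :: "'a::idom fract set set"
  where "fg_ideals = {J \<in> ideals. J \<noteq> {0} \<and> fin_gen J}"

definition colon :: "'a::idom fract set \<Rightarrow> 'a fract set \<Rightarrow> 'a fract set"
  where "colon E H = {x. \<forall>h\<in>H. x * h \<in> E}"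


section \<open>Semistar and star operations\<close>

type_synonym 'a operation = "'a fract set \<Rightarrow> 'a fract set"

text \<open>The four closure axioms, on a family \<open>\<E>\<close> of submodules. A map \<open>\<E> \<rightarrow> \<E>\<close> is an element of the
  extensional function space, so that equality of operations is equality of maps on \<open>\<E>\<close>.\<close>

definition closure_operations :: "'a::idom fract set set \<Rightarrow> 'a operation set"
  where "closure_operations \<E> = {s \<in> \<E> \<rightarrow>\<^sub>E \<E>.
     (\<forall>z. z \<noteq> 0 \<longrightarrow> (\<forall>E\<in>\<E>. s ((\<lambda>x. z * x) ` E) = (\<lambda>x. z * x) ` s E)) \<and>
     (\<forall>E\<in>\<E>. \<forall>F\<in>\<E>. E \<subseteq> F \<longrightarrow> s E \<subseteq> s F) \<and>
     (\<forall>E\<in>\<E>. E \<subseteq> s E) \<and>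
     (\<forall>E\<in>\<E>. s (s E) = s E)}"

definition SStar :: "'a::idom operation set"
  where "SStar = closure_operations Fbar"

definition Star :: "'a::idom operation set"
  where "Star = {s \<in> closure_operations fractional_ideals. s \<D> = \<D>}"

definition finite_type_on :: "'a::idom fract set set \<Rightarrow> 'a operation \<Rightarrow> bool"
  where "finite_type_on \<E> s \<longleftrightarrow> (\<forall>E\<in>\<E>. s E = \<Union>{s F | F. F \<subseteq> E \<and> F \<in> fg_fractional_ideals})"

definition stable_on :: "'a::idom fract set set \<Rightarrow> 'a operation \<Rightarrow> bool"
  where "stable_on \<E> s \<longleftrightarrow> (\<forall>E\<in>\<E>. \<forall>H\<in>\<E>. s (E \<inter> H) = s E \<inter> s H)"


section \<open>Spectral semistar operations\<close>

definition Spec :: "'a::idom fract set set"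
  where "Spec = {P \<in> ideals. P \<noteq> \<D> \<and> (\<forall>a\<in>\<D>. \<forall>b\<in>\<D>. a * b \<in> P \<longrightarrow> a \<in> P \<or> b \<in> P)}"

definition localization :: "'a::idom fract set \<Rightarrow> 'a fract set"
  where "localization P = {a / s | a s. a \<in> \<D> \<and> s \<in> \<D> - P}"

definition submodule_prod :: "'a::idom fract set \<Rightarrow> 'a fract set \<Rightarrow> 'a fract set"
  where "submodule_prod E H = K.span {x * y | x y. x \<in> E \<and> y \<in> H}"

text \<open>For \<open>Y = {}\<close> the intersection is \<open>UNIV\<close>, that is \<open>K\<close>.\<close>

definition spectral_op :: "'a::idom fract set set \<Rightarrow> 'a operation"
  where "spectral_op Y = restrict (\<lambda>E. \<Inter>P\<in>Y. submodule_prod E (localization P)) Fbar"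

definition SStar_fsp :: "'a::idom operation set"
  where "SStar_fsp = {s \<in> SStar. finite_type_on Fbar s \<and> (\<exists>Y \<subseteq> Spec. s = spectral_op Y)}"

definition tilde :: "'a::idom operation \<Rightarrow> 'a operation"
  where "tilde s = restrict (\<lambda>E. \<Union>{colon E J | J. J \<in> fg_ideals \<and> s J = s \<D>}) Fbar"


section \<open>Topologies on sets of semistar operations\<close>

definition V :: "'a::idom fract set \<Rightarrow> 'a operation set"
  where "V E = {s \<in> SStar. 1 \<in> s E}"

definition zariski_SStar :: "'a::idom operation topology"
  where "zariski_SStar = topology_generated_by {V E | E. E \<in> Fbar}"

definition zariski_fsp :: "'a::idom operation topology"
  where "zariski_fsp = subtopology zariski_SStar SStar_fsp"

definition fg_topology_SStar :: "'a::idom operation topology"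
  where "fg_topology_SStar = topology_generated_by {V J | J. J \<in> fg_ideals}"

text \<open>The underlying set of \<^const>\<open>topology_generated_by\<close> is the union of the generating family;
  both families contain \<open>V \<D> = SStar\<close>, so both topologies live on the whole of \<open>SStar\<close>.\<close>

lemma subspace_D: "K.subspace (\<D> :: 'a::idom fract set)"
proof -
  have "to_fract a + to_fract b \<in> (\<D> :: 'a fract set)" "to_fract a * to_fract b \<in> (\<D> :: 'a fract set)"
    for a b :: 'a
    unfolding \<D>_def by (metis to_fract_add rangeI) (metis to_fract_mult rangeI)
  moreover have "0 \<in> (\<D> :: 'a fract set)"
    unfolding \<D>_def by (metis to_fract_0 rangeI)
  ultimately show ?thesis
    unfolding K.subspace_def by (auto simp: \<D>_def)
qed

lemma one_in_D: "1 \<in> (\<D> :: 'a::idom fract set)"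
  unfolding \<D>_def using rangeI[of to_fract "1 :: 'a"] by simp

lemma D_nonzero: "(\<D> :: 'a::idom fract set) \<noteq> {0}"
proof
  assume "(\<D> :: 'a fract set) = {0}"
  then have "(1 :: 'a fract) \<in> {0}"
    using one_in_D[where 'a = 'a] by (rule subst)
  then show False
    by simp
qed

lemma D_in_Fbar: "\<D> \<in> Fbar"
  unfolding Fbar_def using subspace_D D_nonzero by blast

lemma D_in_ideals: "\<D> \<in> ideals"
  unfolding ideals_def using subspace_D by blast

lemma D_in_fg_ideals: "(\<D> :: 'a::idom fract set) \<in> fg_ideals"
proof -
  have "\<D> = K.span {1 :: 'a fract}"
    by (simp add: K.span_singleton \<D>_def)
  then have "fin_gen (\<D> :: 'a fract set)"
    unfolding fin_gen_def by blast
  then show ?thesis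
    unfolding fg_ideals_def using D_in_ideals D_nonzero by blast
qed

lemma V_D: "V \<D> = SStar"
proof -
  have "1 \<in> s \<D>" if "s \<in> SStar" for s :: "'a operation"
  proof -
    have "\<D> \<subseteq> s \<D>"
      using that D_in_Fbar unfolding SStar_def closure_operations_def by blast
    then show ?thesis
      using one_in_D by blast
  qed
  then show ?thesis
    unfolding V_def by blast
qed

lemma topspace_zariski_SStar: "topspace zariski_SStar = SStar"
proof -
  have "\<Union>{V E | E. E \<in> Fbar} \<subseteq> SStar"
    unfolding V_def by blast
  moreover have "SStar \<subseteq> \<Union>{V E | E. E \<in> Fbar}"
    using V_D D_in_Fbar by blast
  ultimately show ?thesis
    unfolding zariski_SStar_def topology_generated_by_topspace by blast
qed

lemma topspace_fg_topology_SStar: "topspace fg_topology_SStar = SStar"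
proof -
  have "\<Union>{V J | J. J \<in> fg_ideals} \<subseteq> SStar"
    unfolding V_def by blast
  moreover have "SStar \<subseteq> \<Union>{V J | J. J \<in> fg_ideals}"
    using V_D D_in_fg_ideals by blast
  ultimately show ?thesis
    unfolding fg_topology_SStar_def topology_generated_by_topspace by blast
qed

text \<open>
  The library realises the Kolmogorov quotient of \<open>X\<close> on a set of representatives of the classes of
  topologically indistinguishable points: \<^const>\<open>Kolmogorov_quotient\<close> \<open>X\<close> is the canonical map, and
  the quotient space is its image. That \<open>f\<close> is the canonical map onto the quotient means that it is
  this map up to a homeomorphism of the quotient space with \<open>Y\<close>.
\<close>

definition canonical_Kolmogorov_map :: "'b topology \<Rightarrow> 'c topology \<Rightarrow> ('b \<Rightarrow> 'c) \<Rightarrow> bool"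
  where "canonical_Kolmogorov_map X Y f \<longleftrightarrow>
    (\<exists>h. homeomorphic_map (subtopology X (Kolmogorov_quotient X ` topspace X)) Y h \<and>
         (\<forall>x\<in>topspace X. f x = h (Kolmogorov_quotient X x)))"


section \<open>Localizing systems\<close>

definition LS :: "'a::idom fract set set set"
  where "LS = {\<F>. \<F> \<noteq> {} \<and> \<F> \<subseteq> ideals - {{0}} \<and>
     (\<forall>I\<in>\<F>. \<forall>J\<in>ideals. I \<subseteq> J \<longrightarrow> J \<in> \<F>) \<and>
     (\<forall>I\<in>\<F>. \<forall>J\<in>ideals. (\<forall>i\<in>I. {d \<in> \<D>. d * i \<in> J} \<in> \<F>) \<longrightarrow> J \<in> \<F>)}"

definition LS_f :: "'a::idom fract set set set"
  where "LS_f = {\<F> \<in> LS. \<forall>I\<in>\<F>. \<exists>J\<in>\<F>. J \<in> fg_ideals \<and> J \<subseteq> I}"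

definition W :: "'a::idom fract set \<Rightarrow> 'a fract set set set"
  where "W I = {\<F> \<in> LS. I \<in> \<F>}"

definition zariski_LS :: "'a::idom fract set set topology"
  where "zariski_LS = topology_generated_by {W I | I. I \<in> ideals}"

definition zariski_LS_f :: "'a::idom fract set set topology"
  where "zariski_LS_f = subtopology zariski_LS LS_f"

definition lambda_op :: "'a::idom fract set set \<Rightarrow> 'a operation"
  where "lambda_op \<F> = restrict (\<lambda>E. \<Union>{colon E H | H. H \<in> \<F>}) Fbar"

lemma topspace_zariski_LS: "topspace (zariski_LS :: 'a::idom fract set set topology) = LS"
proof -
  have "\<D> \<in> \<F>" if "\<F> \<in> LS" for \<F> :: "'a fract set set"
  proof -
    from that have ne: "\<F> \<noteq> {}" and sub: "\<F> \<subseteq> ideals - {{0}}"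
      and up: "\<forall>I\<in>\<F>. \<forall>J\<in>ideals. I \<subseteq> J \<longrightarrow> J \<in> \<F>"
      unfolding LS_def mem_Collect_eq by iprover+
    from ne obtain I where "I \<in> \<F>"
      by (meson ex_in_conv)
    moreover from this sub have "I \<subseteq> \<D>"
      unfolding ideals_def by blast
    ultimately show ?thesis
      using up D_in_ideals by blast
  qed
  then have "W (\<D> :: 'a fract set) = LS"
    unfolding W_def by blast
  then have "LS \<subseteq> \<Union>{W I | I. I \<in> (ideals :: 'a fract set set)}"
    using D_in_ideals by blast
  moreover have "\<Union>{W I | I. I \<in> (ideals :: 'a fract set set)} \<subseteq> LS"
    unfolding W_def by blast
  ultimately show ?thesis
    unfolding zariski_LS_def topology_generated_by_topspace by blast
qed

end

theory Submission imports Defs begin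

text \<open>
  The proof runs through localizing systems. For \<open>x \<in> K\<close> and a submodule \<open>E\<close> of \<open>K\<close> let the conductor of
  \<open>x\<close> be the ideal \<open>(E :\<^sub>D x) = {d \<in> D. dx \<in> E}\<close>. Since a localizing system \<open>\<F>\<close> is closed upwards,
  \<open>E\<^bsup>\<star>\<F>\<^esup> = {x. (E :\<^sub>D x) \<in> \<F>}\<close> (lemma \<open>lambda_op_eq\<close>). Conductors commute with intersections and with
  scaling, so this form shows at once that \<open>\<star>\<F>\<close> is a stable semistar operation, and of finite type if \<open>\<F>\<close>
  is. Conversely, a semistar operation \<open>\<star>\<close> yields the localizing system of finite type \<open>fg_system \<star>\<close> of the
  ideals that contain a finitely generated ideal \<open>J\<close> with \<open>1 \<in> J\<^sup>\<star>\<close> (lemma \<open>fg_system_LS_f\<close>).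

  Three facts relate the two constructions. The operation \<open>tilde \<star>\<close> is the one of \<open>fg_system \<star>\<close> (lemma
  \<open>tilde_eq_lambda_op\<close>). A localizing system of finite type is recovered from its operation (lemma
  \<open>fg_system_lambda_op\<close>). A stable operation of finite type is recovered from its system (lemma
  \<open>lambda_op_fg_system\<close>). Spectral operations are stable because a prime that contains an intersection
  of two ideals contains one of them; conversely, Zorn's lemma produces enough primes outside a localizing
  system of finite type to write its operation as a spectral one (lemma \<open>lambda_op_spectral\<close>). Hence
  \<open>\<F> \<mapsto> \<star>\<F>\<close> is a bijection from \<open>LS\<^sub>f\<close> onto the spectral operations of finite type.

  Under this bijection \<open>V J\<close> corresponds to the systems that contain \<open>J\<close>, which gives the homeomorphism.
  Every \<open>V E\<close> is, on spectral operations of finite type, the union of the \<open>V J\<close> with \<open>J \<subseteq> E\<close> a finitely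
  generated ideal; hence the subbasis. Among the localizing systems of finite type that contain \<open>J\<close> there
  is a least one, and every neighbourhood of its operation contains all of \<open>V J\<close>; hence the quasi-compactness.
  As \<open>\<star>\<close> and \<open>tilde \<star>\<close> have the same system, they lie in the same sets \<open>V J\<close>: the map is continuous already for
  the coarse topology, and for that topology it picks a point indistinguishable from the given one.
  Finally, the recovery of an operation from its system works equally for a star operation on the fractional
  ideals, and the system depends only on the values at finitely generated ideals of \<open>D\<close>; so a stable star operation
  of finite type extends, in one way only.
\<close>

section \<open>Submodules and conductors\<close>

lemma subspace_mult: "K.subspace E \<Longrightarrow> d \<in> \<D> \<Longrightarrow> x \<in> E \<Longrightarrow> d * x \<in> E"
  unfolding \<D>_def by (auto intro: K.subspace_scale)

lemma subspaceI_mult: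
  assumes "0 \<in> E" "\<And>x y. x \<in> E \<Longrightarrow> y \<in> E \<Longrightarrow> x + y \<in> E" "\<And>d x. d \<in> \<D> \<Longrightarrow> x \<in> E \<Longrightarrow> d * x \<in> E"
  shows "K.subspace E"
  using assms unfolding K.subspace_def \<D>_def by auto

lemma zero_in_D: "0 \<in> (\<D> :: 'a::idom fract set)"
  using K.subspace_0[OF subspace_D] .

lemma D_add: "a \<in> \<D> \<Longrightarrow> b \<in> \<D> \<Longrightarrow> a + b \<in> (\<D> :: 'a::idom fract set)"
  using K.subspace_add[OF subspace_D] .

lemma D_mult: "a \<in> \<D> \<Longrightarrow> b \<in> \<D> \<Longrightarrow> a * b \<in> (\<D> :: 'a::idom fract set)"
  using subspace_mult[OF subspace_D] .

lemma subspace_subset_D: "K.subspace E \<Longrightarrow> 1 \<in> E \<Longrightarrow> \<D> \<subseteq> E"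
  using subspace_mult[of E _ 1] by auto

lemma subspace_scaled: "K.subspace E \<Longrightarrow> K.subspace ((\<lambda>x. z * x) ` E)"
proof (rule subspaceI_mult)
  assume E: "K.subspace E"
  show "0 \<in> (\<lambda>x. z * x) ` E"
    using K.subspace_0[OF E] by force
  show "x + y \<in> (\<lambda>x. z * x) ` E" if "x \<in> (\<lambda>x. z * x) ` E" "y \<in> (\<lambda>x. z * x) ` E" for x y
    using that K.subspace_add[OF E] by (auto simp flip: distrib_left)
  show "d * x \<in> (\<lambda>x. z * x) ` E" if "d \<in> \<D>" "x \<in> (\<lambda>x. z * x) ` E" for d x
    using that subspace_mult[OF E] by (auto simp: mult.left_commute[of d z])
qed

lemma span_scaled:
  fixes G :: "'a::idom fract set"
  shows "K.span ((\<lambda>x. z * x) ` G) = (\<lambda>x. z * x) ` K.span G"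
proof
  show "K.span ((\<lambda>x. z * x) ` G) \<subseteq> (\<lambda>x. z * x) ` K.span G"
    by (intro K.span_minimal subspace_scaled K.subspace_span image_mono K.span_superset)
  have "K.span G \<subseteq> {x. z * x \<in> K.span ((\<lambda>x. z * x) ` G)}"
  proof (rule K.span_minimal)
    show "G \<subseteq> {x. z * x \<in> K.span ((\<lambda>x. z * x) ` G)}"
      by (auto intro: K.span_base)
    show "K.subspace {x. z * x \<in> K.span ((\<lambda>x. z * x) ` G)}"
      using subspace_mult[OF K.subspace_span]
      by (intro subspaceI_mult)
        (auto simp: distrib_left mult.left_commute[of z] intro: K.span_add K.span_zero)
  qed
  then show "(\<lambda>x. z * x) ` K.span G \<subseteq> K.span ((\<lambda>x. z * x) ` G)"
    by blast
qed

lemma nonzero_element: "K.subspace E \<Longrightarrow> E \<noteq> {0} \<Longrightarrow> \<exists>x\<in>E. x \<noteq> 0"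
  using K.subspace_0 by blast

lemma Fbar_subspace: "E \<in> Fbar \<Longrightarrow> K.subspace E"
  by (simp add: Fbar_def)

lemma FbarI: "K.subspace E \<Longrightarrow> x \<in> E \<Longrightarrow> x \<noteq> 0 \<Longrightarrow> E \<in> Fbar"
  by (auto simp: Fbar_def)

lemma Fbar_scaled: "E \<in> Fbar \<Longrightarrow> z \<noteq> 0 \<Longrightarrow> (\<lambda>x. z * x) ` E \<in> Fbar"
proof -
  assume E: "E \<in> Fbar" and z: "z \<noteq> 0"
  then obtain e where "e \<in> E" "e \<noteq> 0"
    using nonzero_element by (auto simp: Fbar_def)
  then have "z * e \<in> (\<lambda>x. z * x) ` E" "z * e \<noteq> 0"
    using z by auto
  then show ?thesis
    using subspace_scaled[OF Fbar_subspace[OF E]] unfolding Fbar_def by blast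
qed

lemma fraction_numerator:
  fixes x :: "'a::idom fract"
  obtains d where "d \<in> \<D>" "d \<noteq> 0" "d * x \<in> \<D>"
proof (cases x)
  case (Fract a b)
  then have "to_fract b * x = to_fract a"
    by (simp add: Fract_conv_to_fract)
  then show ?thesis
    using that[of "to_fract b"] Fract by (auto simp: \<D>_def)
qed

lemma ideals_subset_Fbar: "ideals - {{0}} \<subseteq> Fbar"
  by (auto simp: ideals_def Fbar_def)

lemma fg_ideals_subset_ideals: "fg_ideals \<subseteq> ideals - {{0}}"
  by (auto simp: fg_ideals_def)

lemma ideals_subset_fractional_ideals: "ideals - {{0}} \<subseteq> (fractional_ideals :: 'a::idom fract set set)"
proof
  fix I :: "'a fract set" assume I: "I \<in> ideals - {{0}}"
  then have "\<exists>d\<in>\<D>. d \<noteq> 0 \<and> (\<lambda>x. d * x) ` I \<subseteq> \<D>"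
    by (intro bexI[of _ 1]) (simp_all add: one_in_D ideals_def)
  moreover have "I \<in> Fbar"
    using I ideals_subset_Fbar by (rule subsetD[rotated])
  ultimately show "I \<in> fractional_ideals"
    by (simp add: fractional_ideals_def)
qed

lemma fg_ideals_iff: "J \<in> fg_ideals \<longleftrightarrow> J \<in> fg_fractional_ideals \<and> J \<subseteq> \<D>"
proof
  assume J: "J \<in> fg_ideals"
  then have "J \<in> fractional_ideals"
    by (intro subsetD[OF ideals_subset_fractional_ideals]) (simp add: fg_ideals_def)
  then show "J \<in> fg_fractional_ideals \<and> J \<subseteq> \<D>"
    using J by (simp add: fg_ideals_def fg_fractional_ideals_def ideals_def)
next
  assume "J \<in> fg_fractional_ideals \<and> J \<subseteq> \<D>"
  then show "J \<in> fg_ideals"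
    by (simp add: fg_ideals_def fg_fractional_ideals_def fractional_ideals_def Fbar_def ideals_def)
qed

lemma fractional_ideals_scaled:
  assumes "E \<in> fractional_ideals" "z \<noteq> 0"
  shows "(\<lambda>x. z * x) ` E \<in> fractional_ideals"
proof -
  from assms obtain d where d: "d \<in> \<D>" "d \<noteq> 0" "(\<lambda>x. d * x) ` E \<subseteq> \<D>"
    by (auto simp: fractional_ideals_def)
  obtain c where c: "c \<in> \<D>" "c \<noteq> 0" "c * z \<in> \<D>"
    using fraction_numerator .
  have "(c * d) * (z * x) \<in> \<D>" if "x \<in> E" for x
    using D_mult[OF c(3), of "d * x"] d(3) that by (auto simp: mult_ac)
  then have "\<exists>d\<in>\<D>. d \<noteq> 0 \<and> (\<lambda>x. d * x) ` (\<lambda>x. z * x) ` E \<subseteq> \<D>"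
    using c d D_mult by (intro bexI[of _ "c * d"]) auto
  moreover have "(\<lambda>x. z * x) ` E \<in> Fbar"
    using assms(1) by (intro Fbar_scaled[OF _ assms(2)]) (simp add: fractional_ideals_def)
  ultimately show ?thesis
    by (simp add: fractional_ideals_def)
qed

lemma fg_fractional_ideals_scaled:
  assumes "E \<in> fg_fractional_ideals" "z \<noteq> 0"
  shows "(\<lambda>x. z * x) ` E \<in> fg_fractional_ideals"
proof -
  from assms obtain G where "finite G" "E = K.span G"
    by (auto simp: fg_fractional_ideals_def fin_gen_def)
  then have "fin_gen ((\<lambda>x. z * x) ` E)"
    unfolding fin_gen_def by (metis span_scaled finite_imageI)
  then show ?thesis
    using fractional_ideals_scaled[OF _ assms(2), of E] assms(1) by (simp add: fg_fractional_ideals_def)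
qed

definition conductor :: "'a::idom fract set \<Rightarrow> 'a fract \<Rightarrow> 'a fract set"
  where "conductor E x = {d \<in> \<D>. d * x \<in> E}"

lemma conductor_subset_D: "conductor E x \<subseteq> \<D>"
  by (auto simp: conductor_def)

lemma conductor_subspace: "K.subspace E \<Longrightarrow> K.subspace (conductor E x)"
  unfolding conductor_def
  by (rule subspaceI_mult)
    (auto simp: zero_in_D D_add D_mult distrib_right mult.assoc subspace_mult K.subspace_0 K.subspace_add)

lemma conductor_in_ideals: "K.subspace E \<Longrightarrow> conductor E x \<in> ideals"
  by (simp add: ideals_def conductor_subspace conductor_subset_D)

lemma conductor_1: "I \<in> ideals \<Longrightarrow> conductor I 1 = I"
  by (auto simp: conductor_def ideals_def)

lemma conductor_mem: "K.subspace E \<Longrightarrow> x \<in> E \<Longrightarrow> conductor E x = \<D>"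
  by (auto simp: conductor_def subspace_mult)

lemma conductor_Int: "conductor (E \<inter> F) x = conductor E x \<inter> conductor F x"
  by (auto simp: conductor_def)

lemma conductor_scaled: "z \<noteq> 0 \<Longrightarrow> conductor ((\<lambda>x. z * x) ` E) (z * x) = conductor E x"
proof -
  assume "z \<noteq> 0"
  then have "d * (z * x) \<in> (\<lambda>x. z * x) ` E \<longleftrightarrow> d * x \<in> E" for d
    using inj_image_mem_iff[of "\<lambda>x. z * x" "d * x" E] by (simp add: inj_def mult.left_commute)
  then show ?thesis
    by (simp add: conductor_def)
qed

lemma conductor_conductor: "i \<in> \<D> \<Longrightarrow> conductor (conductor E x) i = conductor E (i * x)"
  by (auto simp: conductor_def D_mult mult.assoc)

lemma conductor_nonzero:
  fixes E :: "'a::idom fract set"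
  assumes "E \<in> Fbar"
  shows "conductor E x \<noteq> {0}"
proof -
  obtain e where e: "e \<in> E" "e \<noteq> 0"
    using assms nonzero_element by (auto simp: Fbar_def)
  obtain d where d: "d \<in> \<D>" "d \<noteq> 0" "d * (x / e) \<in> \<D>"
    using fraction_numerator .
  have "d * (x / e) * e \<in> E"
    using subspace_mult[OF Fbar_subspace[OF assms] d(3) e(1)] .
  then have "d \<in> conductor E x"
    using d e by (simp add: conductor_def)
  then show ?thesis
    using d by blast
qed

text \<open>The unions of modules \<open>(E : H)\<close> that define \<open>\<star>\<^sub>\<F>\<close> and \<open>tilde\<close> become conditions on the conductor.\<close>

lemma mem_colon_iff: "H \<subseteq> \<D> \<Longrightarrow> x \<in> colon E H \<longleftrightarrow> H \<subseteq> conductor E x"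
  by (auto simp: colon_def conductor_def mult.commute)


section \<open>Semistar operations from localizing systems\<close>

lemma LS_iff:
  "\<F> \<in> LS \<longleftrightarrow> \<F> \<noteq> {} \<and> \<F> \<subseteq> ideals - {{0}} \<and>
     (\<forall>I\<in>\<F>. \<forall>J\<in>ideals. I \<subseteq> J \<longrightarrow> J \<in> \<F>) \<and>
     (\<forall>I\<in>\<F>. \<forall>J\<in>ideals. (\<forall>i\<in>I. conductor J i \<in> \<F>) \<longrightarrow> J \<in> \<F>)"
  by (simp only: LS_def mem_Collect_eq conductor_def)

lemma LS_D:
  assumes "\<F> \<in> LS" "I \<in> \<F>" shows "I \<in> ideals \<and> I \<noteq> {0}"
  using LS_iff[THEN iffD1, OF assms(1), THEN conjunct2, THEN conjunct1] assms(2) by (auto dest: subsetD)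

lemma LS_up:
  assumes "\<F> \<in> LS" "I \<in> \<F>" "J \<in> ideals" "I \<subseteq> J" shows "J \<in> \<F>"
  using LS_iff[THEN iffD1, OF assms(1), THEN conjunct2, THEN conjunct2, THEN conjunct1] assms(2-) by metis

lemma LS_conductor:
  assumes "\<F> \<in> LS" "I \<in> \<F>" "J \<in> ideals" "\<And>i. i \<in> I \<Longrightarrow> conductor J i \<in> \<F>"
  shows "J \<in> \<F>"
  using LS_iff[THEN iffD1, OF assms(1), THEN conjunct2, THEN conjunct2, THEN conjunct2] assms(2-) by metis

lemma LSI:
  assumes "\<D> \<in> \<F>" "\<F> \<subseteq> ideals - {{0}}"
    "\<And>I J. I \<in> \<F> \<Longrightarrow> J \<in> ideals \<Longrightarrow> I \<subseteq> J \<Longrightarrow> J \<in> \<F>"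
    "\<And>I J. I \<in> \<F> \<Longrightarrow> J \<in> ideals \<Longrightarrow> (\<And>i. i \<in> I \<Longrightarrow> conductor J i \<in> \<F>) \<Longrightarrow> J \<in> \<F>"
  shows "\<F> \<in> LS"
  unfolding LS_iff
proof (intro conjI ballI impI)
  show "\<F> \<noteq> {}"
    using assms(1) by blast
qed (fact assms(2), erule assms(3), assumption+, erule assms(4), assumption, erule bspec)

lemma D_in_LS:
  assumes "\<F> \<in> LS" shows "\<D> \<in> \<F>"
proof -
  from assms obtain I where "I \<in> \<F>"
    using LS_iff[THEN iffD1, OF assms, THEN conjunct1] by blast
  then show ?thesis
    using LS_up[OF assms _ D_in_ideals] LS_D[OF assms] by (auto simp: ideals_def)
qed

text \<open>For \<open>i \<in> I\<close> the conductor of \<open>i\<close> into \<open>I \<inter> J\<close> contains \<open>J\<close>, so axiom (ii) applies to \<open>I\<close>.\<close>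

lemma LS_Int:
  assumes F: "\<F> \<in> LS" and I: "I \<in> \<F>" and J: "J \<in> \<F>"
  shows "I \<inter> J \<in> \<F>"
proof (rule LS_conductor[OF F I])
  have IJ: "I \<in> ideals" "J \<in> ideals"
    using LS_D[OF F] I J by auto
  then show "I \<inter> J \<in> ideals"
    by (auto simp: ideals_def K.subspace_inter)
  show "conductor (I \<inter> J) i \<in> \<F>" if i: "i \<in> I" for i
  proof (rule LS_up[OF F J])
    show "conductor (I \<inter> J) i \<in> ideals"
      using \<open>I \<inter> J \<in> ideals\<close> by (auto simp: ideals_def conductor_in_ideals conductor_subspace conductor_subset_D)
    have "j * i \<in> I \<inter> J" if "j \<in> J" for j
    proof -
      have "i \<in> \<D>" "j \<in> \<D>"
        using i that IJ by (auto simp: ideals_def)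
      then show ?thesis
        using i that IJ subspace_mult[of I j i] subspace_mult[of J i j]
        by (auto simp: ideals_def mult.commute)
    qed
    then show "J \<subseteq> conductor (I \<inter> J) i"
      using IJ by (auto simp: conductor_def ideals_def)
  qed
qed

lemma LS_f_subset_LS: "LS_f \<subseteq> LS"
  by (auto simp: LS_f_def)

text \<open>A localizing system is closed upwards, so that some member of it carries \<open>x\<close> into \<open>E\<close> exactly
  when the largest candidate, the conductor, is itself a member. All the properties of \<open>\<star>\<^sub>\<F>\<close> are read
  off from this form.\<close>

lemma lambda_op_eq:
  assumes F: "\<F> \<in> LS" and E: "E \<in> Fbar"
  shows "lambda_op \<F> E = {x. conductor E x \<in> \<F>}"
proof -
  have "x \<in> lambda_op \<F> E \<longleftrightarrow> (\<exists>H\<in>\<F>. H \<subseteq> conductor E x)" for x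
    using E mem_colon_iff[of _ x E] LS_D[OF F] by (auto simp: lambda_op_def ideals_def)
  then show ?thesis
    using LS_up[OF F _ conductor_in_ideals[OF Fbar_subspace[OF E]]] by auto
qed

lemma lambda_op_mono: "E \<in> Fbar \<Longrightarrow> H \<in> Fbar \<Longrightarrow> E \<subseteq> H \<Longrightarrow> lambda_op \<F> E \<subseteq> lambda_op \<F> H"
  by (auto simp: lambda_op_def colon_def)

lemma lambda_op_extensive:
  assumes "\<F> \<in> LS" "E \<in> Fbar" shows "E \<subseteq> lambda_op \<F> E"
  using assms D_in_LS[of \<F>] by (auto simp: lambda_op_eq conductor_mem Fbar_subspace)

lemma lambda_op_Fbar:
  fixes E :: "'a::idom fract set"
  assumes F: "\<F> \<in> LS" and E: "E \<in> Fbar"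
  shows "lambda_op \<F> E \<in> Fbar"
proof -
  note sub = Fbar_subspace[OF E]
  have "K.subspace {x. conductor E x \<in> \<F>}"
  proof (rule subspaceI_mult)
    show "0 \<in> {x. conductor E x \<in> \<F>}"
      using conductor_mem[OF sub K.subspace_0[OF sub]] D_in_LS[OF F] by simp
  next
    fix x y assume "x \<in> {x. conductor E x \<in> \<F>}" "y \<in> {x. conductor E x \<in> \<F>}"
    then have "conductor E x \<inter> conductor E y \<in> \<F>"
      using LS_Int[OF F] by simp
    moreover have "conductor E x \<inter> conductor E y \<subseteq> conductor E (x + y)"
      by (auto simp: conductor_def distrib_left K.subspace_add[OF sub])
    ultimately show "x + y \<in> {x. conductor E x \<in> \<F>}"
      using LS_up[OF F _ conductor_in_ideals[OF sub]] by blast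
  next
    fix d x :: "'a fract"
    assume d: "d \<in> \<D>" and "x \<in> {x. conductor E x \<in> \<F>}"
    moreover have "conductor E x \<subseteq> conductor E (d * x)"
      using subspace_mult[OF sub d] by (auto simp: conductor_def mult.left_commute[of _ d])
    ultimately show "d * x \<in> {x. conductor E x \<in> \<F>}"
      using LS_up[OF F _ conductor_in_ideals[OF sub]] by blast
  qed
  then show ?thesis
    using lambda_op_extensive[OF assms] E K.subspace_0[OF sub] unfolding lambda_op_eq[OF assms] Fbar_def
    by blast
qed

lemma lambda_op_scaled:
  fixes E :: "'a::idom fract set"
  assumes F: "\<F> \<in> LS" and E: "E \<in> Fbar" and z: "z \<noteq> 0"
  shows "lambda_op \<F> ((\<lambda>x. z * x) ` E) = (\<lambda>x. z * x) ` lambda_op \<F> E"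
proof -
  have im: "x \<in> (\<lambda>x. z * x) ` A \<longleftrightarrow> x / z \<in> A" for x and A :: "'a fract set"
    using z by (auto simp: image_iff field_simps intro!: bexI[of _ "x / z"])
  have cond: "conductor ((\<lambda>x. z * x) ` E) x = conductor E (x / z)" for x
    using conductor_scaled[OF z, of E "x / z"] z by simp
  show ?thesis
    unfolding lambda_op_eq[OF F Fbar_scaled[OF E z]] lambda_op_eq[OF F E] cond
    by (rule set_eqI) (simp only: im mem_Collect_eq)
qed

text \<open>Axiom (ii) of a localizing system gives idempotence: an element \<open>i\<close> of the conductor of \<open>x\<close> into
  \<open>E\<^sup>\<star>\<close> has \<open>ix \<in> E\<^sup>\<star>\<close>, and the conductor of \<open>ix\<close> is that of \<open>i\<close> into the conductor of \<open>x\<close>.\<close>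

lemma lambda_op_idem:
  assumes F: "\<F> \<in> LS" and E: "E \<in> Fbar"
  shows "lambda_op \<F> (lambda_op \<F> E) = lambda_op \<F> E"
proof
  show "lambda_op \<F> E \<subseteq> lambda_op \<F> (lambda_op \<F> E)"
    by (intro lambda_op_extensive lambda_op_Fbar assms)
  show "lambda_op \<F> (lambda_op \<F> E) \<subseteq> lambda_op \<F> E"
  proof
    fix x assume "x \<in> lambda_op \<F> (lambda_op \<F> E)"
    then have x: "conductor (lambda_op \<F> E) x \<in> \<F>"
      using lambda_op_eq[OF F lambda_op_Fbar[OF assms]] by simp
    have "conductor E x \<in> \<F>"
    proof (rule LS_conductor[OF F x])
      show "conductor E x \<in> ideals"
        using conductor_in_ideals[OF Fbar_subspace[OF E]] .
      show "conductor (conductor E x) i \<in> \<F>" if "i \<in> conductor (lambda_op \<F> E) x" for i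
      proof -
        have "i \<in> \<D>" "i * x \<in> lambda_op \<F> E"
          using that by (simp_all only: conductor_def mem_Collect_eq)
        then show ?thesis
          by (simp add: conductor_conductor lambda_op_eq[OF assms])
      qed
    qed
    then show "x \<in> lambda_op \<F> E"
      using lambda_op_eq[OF assms] by simp
  qed
qed

lemma lambda_op_SStar: "\<F> \<in> LS \<Longrightarrow> lambda_op \<F> \<in> SStar"
  unfolding SStar_def closure_operations_def mem_Collect_eq
  by (intro conjI ballI allI impI PiE_I lambda_op_Fbar lambda_op_scaled lambda_op_mono
      lambda_op_extensive lambda_op_idem) (simp_all add: lambda_op_def)

lemma Fbar_Int:
  assumes E: "E \<in> Fbar" and H: "H \<in> Fbar"
  shows "E \<inter> H \<in> Fbar"
proof -
  obtain e where e: "e \<in> E" "e \<noteq> 0"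
    using E nonzero_element by (auto simp: Fbar_def)
  obtain d where d: "d \<in> conductor H e" "d \<noteq> 0"
    using nonzero_element[OF conductor_subspace[OF Fbar_subspace[OF H]] conductor_nonzero[OF H]] by blast
  have "d * e \<in> E \<inter> H" "d * e \<noteq> 0"
    using e d subspace_mult[OF Fbar_subspace[OF E]] by (auto simp: conductor_def)
  then show ?thesis
    using FbarI K.subspace_inter[OF Fbar_subspace[OF E] Fbar_subspace[OF H]] by blast
qed

lemma stable_lambda_op:
  fixes \<F> :: "'a::idom fract set set"
  assumes F: "\<F> \<in> LS" shows "stable_on Fbar (lambda_op \<F>)"
  unfolding stable_on_def
proof (intro ballI)
  fix E H :: "'a fract set" assume E: "E \<in> Fbar" "H \<in> Fbar"
  have "conductor E x \<inter> conductor H x \<in> \<F> \<longleftrightarrow> conductor E x \<in> \<F> \<and> conductor H x \<in> \<F>" for x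
    using LS_Int[OF F] LS_up[OF F _ conductor_in_ideals[OF Fbar_subspace]] E by blast
  then show "lambda_op \<F> (E \<inter> H) = lambda_op \<F> E \<inter> lambda_op \<F> H"
    using E F by (auto simp: lambda_op_eq Fbar_Int conductor_Int)
qed

lemma one_in_lambda_op_iff:
  "\<F> \<in> LS \<Longrightarrow> I \<in> ideals - {{0}} \<Longrightarrow> 1 \<in> lambda_op \<F> I \<longleftrightarrow> I \<in> \<F>"
  using ideals_subset_Fbar by (auto simp: lambda_op_eq conductor_1)

lemma finite_type_lambda_op:
  fixes \<F> :: "'a::idom fract set set"
  assumes F: "\<F> \<in> LS_f" shows "finite_type_on Fbar (lambda_op \<F>)"
  unfolding finite_type_on_def
proof (intro ballI equalityI subsetI)
  have F': "\<F> \<in> LS"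
    using F LS_f_subset_LS by blast
  fix E :: "'a fract set" and x
  assume E: "E \<in> Fbar" 
  { assume "x \<in> \<Union>{lambda_op \<F> G |G. G \<subseteq> E \<and> G \<in> fg_fractional_ideals}"
    then show "x \<in> lambda_op \<F> E"
      using lambda_op_mono[OF _ E] by (auto simp: fg_fractional_ideals_def fractional_ideals_def) }
  assume x: "x \<in> lambda_op \<F> E"
  \<comment> \<open>The witness \<open>yJ\<close> has to be a nonzero module. For \<open>x = 0\<close> any nonzero \<open>y\<close> will do, since closures contain \<open>0\<close>.\<close>
  obtain y where y: "y \<in> lambda_op \<F> E" "y \<noteq> 0" "x \<noteq> 0 \<longrightarrow> y = x"
    using x nonzero_element lambda_op_Fbar[OF F' E] by (auto simp: Fbar_def)
  then have "conductor E y \<in> \<F>"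
    using lambda_op_eq[OF F' E] by simp
  then obtain J where J: "J \<in> \<F>" "J \<in> fg_ideals" "J \<subseteq> conductor E y"
    using F by (auto simp: LS_f_def)
  let ?G = "(\<lambda>x. y * x) ` J"
  have G: "?G \<in> fg_fractional_ideals"
    using J fg_ideals_iff fg_fractional_ideals_scaled y by blast
  then have G': "?G \<in> Fbar"
    by (auto simp: fg_fractional_ideals_def fractional_ideals_def)
  have "?G \<subseteq> E"
    using J by (auto simp: conductor_def mult.commute)
  moreover have "J \<subseteq> conductor ?G y"
    using J by (auto simp: conductor_def mult.commute fg_ideals_def ideals_def)
  then have "y \<in> lambda_op \<F> ?G"
    using lambda_op_eq[OF F' G'] LS_up[OF F' J(1) conductor_in_ideals[OF Fbar_subspace[OF G']]] by simp
  then have "x \<in> lambda_op \<F> ?G"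
    using y K.subspace_0[OF Fbar_subspace[OF lambda_op_Fbar[OF F' G']]] by auto
  ultimately show "x \<in> \<Union>{lambda_op \<F> G |G. G \<subseteq> E \<and> G \<in> fg_fractional_ideals}"
    using G by blast
qed


section \<open>Spectral operations\<close>

lemma Spec_multiplicative:
  assumes P: "P \<in> Spec"
  shows "1 \<notin> P" "s \<in> \<D> - P \<Longrightarrow> t \<in> \<D> - P \<Longrightarrow> s * t \<in> \<D> - P"
proof -
  show "1 \<notin> P"
    using P subspace_subset_D by (auto simp: Spec_def ideals_def)
  show "s \<in> \<D> - P \<Longrightarrow> t \<in> \<D> - P \<Longrightarrow> s * t \<in> \<D> - P"
    using P D_mult by (auto simp: Spec_def)
qed

text \<open>Clearing denominators: \<open>x \<in> ED\<^sub>P\<close> means \<open>sx \<in> E\<close> for some \<open>s \<in> D - P\<close>.\<close>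

lemma submodule_prod_localization:
  fixes E P :: "'a::idom fract set"
  assumes P: "P \<in> Spec" and E: "K.subspace E"
  shows "submodule_prod E (localization P) = {x. \<not> conductor E x \<subseteq> P}"
proof
  have P0: "0 \<in> P"
    using P K.subspace_0 by (auto simp: Spec_def ideals_def)
  have "\<not> conductor E x \<subseteq> P \<longleftrightarrow> (\<exists>s\<in>\<D> - P. s * x \<in> E)" for x
    by (auto simp: conductor_def)
  then have eq: "{x. \<not> conductor E x \<subseteq> P} = {x. \<exists>s\<in>\<D> - P. s * x \<in> E}"
    by simp
  show "submodule_prod E (localization P) \<subseteq> {x. \<not> conductor E x \<subseteq> P}"
    unfolding submodule_prod_def eq
  proof (rule K.span_minimal)
    show "{x * y |x y. x \<in> E \<and> y \<in> localization P} \<subseteq> {x. \<exists>s\<in>\<D> - P. s * x \<in> E}"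
    proof clarify
      fix e y assume e: "e \<in> E" and "y \<in> localization P"
      then obtain a s where a: "a \<in> \<D>" "s \<in> \<D> - P" "y = a / s"
        by (auto simp: localization_def)
      then have "s * (e * y) = a * e"
        using P0 by auto
      then show "\<exists>s\<in>\<D> - P. s * (e * y) \<in> E"
        using a e subspace_mult[OF E] by metis
    qed
    show "K.subspace {x. \<exists>s\<in>\<D> - P. s * x \<in> E}"
    proof (rule subspaceI_mult)
      show "0 \<in> {x. \<exists>s\<in>\<D> - P. s * x \<in> E}"
        using K.subspace_0[OF E] Spec_multiplicative(1)[OF P] one_in_D by auto
    next
      fix x y assume "x \<in> {x. \<exists>s\<in>\<D> - P. s * x \<in> E}" "y \<in> {x. \<exists>s\<in>\<D> - P. s * x \<in> E}"
      then obtain s t where st: "s \<in> \<D> - P" "s * x \<in> E" "t \<in> \<D> - P" "t * y \<in> E"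
        by blast
      have "t * (s * x) + s * (t * y) \<in> E"
        using st K.subspace_add[OF E subspace_mult[OF E, of t "s * x"] subspace_mult[OF E, of s "t * y"]]
        by blast
      then have "(s * t) * (x + y) \<in> E"
        by (simp add: algebra_simps)
      then show "x + y \<in> {x. \<exists>s\<in>\<D> - P. s * x \<in> E}"
        using Spec_multiplicative(2)[OF P st(1,3)] by blast
    next
      fix d x :: "'a fract"
      assume "d \<in> \<D>" "x \<in> {x. \<exists>s\<in>\<D> - P. s * x \<in> E}"
      then show "d * x \<in> {x. \<exists>s\<in>\<D> - P. s * x \<in> E}"
        using subspace_mult[OF E] by (auto simp: mult.left_commute[of _ d])
    qed
  qed
  show "{x. \<not> conductor E x \<subseteq> P} \<subseteq> submodule_prod E (localization P)"
    unfolding eq submodule_prod_def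
  proof (clarify, rule K.span_base, clarify)
    fix x s assume s: "s \<in> \<D>" "s \<notin> P" "s * x \<in> E"
    then have "x = (s * x) * (1 / s)" "1 / s \<in> localization P"
      using P0 one_in_D by (auto simp: localization_def)
    then show "\<exists>y z. x = y * z \<and> y \<in> E \<and> z \<in> localization P"
      using s by blast
  qed
qed

lemma spectral_op_eq:
  assumes "Y \<subseteq> Spec" "E \<in> Fbar"
  shows "spectral_op Y E = {x. \<forall>P\<in>Y. \<not> conductor E x \<subseteq> P}"
proof -
  have "submodule_prod E (localization P) = {x. \<not> conductor E x \<subseteq> P}" if "P \<in> Y" for P
    using submodule_prod_localization[OF _ Fbar_subspace] assms that by blast
  then show ?thesis
    using assms(2) by (auto simp: spectral_op_def)
qed

lemma prime_Int_subset:
  assumes P: "P \<in> Spec" and I: "I \<in> ideals" and J: "J \<in> ideals" and sub: "I \<inter> J \<subseteq> P"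
  shows "I \<subseteq> P \<or> J \<subseteq> P"
proof (rule ccontr)
  assume "\<not> (I \<subseteq> P \<or> J \<subseteq> P)"
  then obtain a b where ab: "a \<in> I" "a \<notin> P" "b \<in> J" "b \<notin> P"
    by blast
  then have D: "a \<in> \<D>" "b \<in> \<D>"
    using I J by (auto simp: ideals_def)
  then have "a * b \<in> \<D> - P"
    using Spec_multiplicative(2)[OF P] ab by blast
  moreover have "a * b \<in> I \<inter> J"
    using ab D I J subspace_mult[of I b a] subspace_mult[of J a b] by (auto simp: ideals_def mult.commute)
  ultimately show False
    using sub by blast
qed

text \<open>This is the flatness of localizations, \<open>(E \<inter> H)D\<^sub>P = ED\<^sub>P \<inter> HD\<^sub>P\<close>: the conductor turns
  intersections into intersections, and a prime contains an intersection of two ideals only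
  if it contains one of them.\<close>

lemma stable_spectral_op:
  fixes Y :: "'a::idom fract set set"
  assumes Y: "Y \<subseteq> Spec" shows "stable_on Fbar (spectral_op Y)"
  unfolding stable_on_def
proof (intro ballI)
  fix E H :: "'a fract set" assume E: "E \<in> Fbar" "H \<in> Fbar"
  have "conductor E x \<inter> conductor H x \<subseteq> P \<longleftrightarrow> conductor E x \<subseteq> P \<or> conductor H x \<subseteq> P"
    if "P \<in> Y" for x P
    using prime_Int_subset[OF _ conductor_in_ideals conductor_in_ideals] that Y E Fbar_subspace by blast
  then show "spectral_op Y (E \<inter> H) = spectral_op Y E \<inter> spectral_op Y H"
    using E Y by (auto simp: spectral_op_eq Fbar_Int conductor_Int)
qed

lemma Union_chain_ideals:
  assumes ne: "C \<noteq> {}" and ch: "subset.chain A C" and A: "A \<subseteq> ideals"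
  shows "\<Union>C \<in> ideals"
proof -
  have CI: "C \<subseteq> ideals" and cmp: "\<And>I J. I \<in> C \<Longrightarrow> J \<in> C \<Longrightarrow> I \<subseteq> J \<or> J \<subseteq> I"
    using ch A unfolding subset_chain_def by blast+
  have "K.subspace (\<Union>C)"
  proof (rule subspaceI_mult)
    show "0 \<in> \<Union>C"
      using ne CI K.subspace_0 by (auto simp: ideals_def)
    show "x + y \<in> \<Union>C" if xy: "x \<in> \<Union>C" "y \<in> \<Union>C" for x y
    proof -
      from xy obtain I J where "I \<in> C" "x \<in> I" "J \<in> C" "y \<in> J"
        by blast
      then obtain L where "L \<in> C" "x \<in> L" "y \<in> L"
        using cmp by blast
      moreover from this have "K.subspace L"
        using CI by (auto simp: ideals_def)
      ultimately show ?thesis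
        using K.subspace_add by blast
    qed
    show "d * x \<in> \<Union>C" if "d \<in> \<D>" "x \<in> \<Union>C" for d x
    proof -
      from that obtain L where "L \<in> C" "x \<in> L"
        by blast
      moreover from this have "K.subspace L"
        using CI by (auto simp: ideals_def)
      ultimately show ?thesis
        using subspace_mult that by blast
    qed
  qed
  then show ?thesis
    using CI by (auto simp: ideals_def)
qed

text \<open>Among the ideals above \<open>I\<close> outside \<open>\<F>\<close> there is a maximal one \<open>M\<close>, since by finite type the union of a chain
  of such ideals stays outside \<open>\<F>\<close>. It is prime: if \<open>ab \<in> M\<close> but \<open>a, b \<notin> M\<close>, then \<open>(M :\<^sub>D a)\<close> and \<open>M + aD\<close> are
  strictly larger and so belong to \<open>\<F>\<close>. Every element of \<open>M + aD\<close> is carried into \<open>M\<close> by \<open>(M :\<^sub>D a)\<close>, and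
  axiom (ii) puts \<open>M\<close> into \<open>\<F>\<close>.\<close>

lemma prime_avoiding_LS_f:
  assumes F: "\<F> \<in> LS_f" and I: "I \<in> ideals" "I \<notin> \<F>"
  obtains P where "P \<in> Spec" "I \<subseteq> P" "P \<notin> \<F>"
proof -
  have F': "\<F> \<in> LS"
    using F LS_f_subset_LS by blast
  define A where "A = {J \<in> ideals. I \<subseteq> J \<and> J \<notin> \<F>}"
  have "\<exists>M\<in>A. \<forall>X\<in>A. M \<subseteq> X \<longrightarrow> X = M"
  proof (rule subset_Zorn_nonempty)
    show "A \<noteq> {}"
      using I A_def by auto
    fix C assume C: "C \<noteq> {}" and ch: "subset.chain A C"
    then have CA: "C \<subseteq> A"
      by (auto simp: subset.chain_def)
    have ideal: "\<Union>C \<in> ideals"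
      using Union_chain_ideals[OF C ch] A_def by auto
    have "\<Union>C \<notin> \<F>"
    proof
      assume "\<Union>C \<in> \<F>"
      then obtain J where J: "J \<in> \<F>" "J \<in> fg_ideals" "J \<subseteq> \<Union>C"
        using F by (auto simp: LS_f_def)
      then obtain G where G: "finite G" "J = K.span G"
        by (auto simp: fg_ideals_def fin_gen_def)
      \<comment> \<open>the finitely many generators already lie in one member of the chain\<close>
      then obtain B where B: "B \<in> C" "G \<subseteq> B"
        using finite_subset_Union_chain[OF G(1) _ C ch] J K.span_superset by blast
      then have "J \<subseteq> B" "B \<in> ideals" "B \<notin> \<F>"
        using G CA A_def K.span_minimal[of G B] by (auto simp: ideals_def)
      then show False
        using LS_up[OF F' J(1)] by blast
    qed
    then show "\<Union>C \<in> A"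
      using ideal C CA A_def by auto
  qed
  then obtain M where M: "M \<in> ideals" "I \<subseteq> M" "M \<notin> \<F>"
    and max: "\<And>X. X \<in> ideals \<Longrightarrow> M \<subseteq> X \<Longrightarrow> X \<notin> \<F> \<Longrightarrow> X = M"
    unfolding A_def by (smt (verit, best) mem_Collect_eq order_trans)
  have Ms: "K.subspace M" "M \<subseteq> \<D>"
    using M by (auto simp: ideals_def)
  have "b \<in> M" if a: "a \<in> \<D>" "a \<notin> M" and b: "b \<in> \<D>" and ab: "a * b \<in> M" for a b
  proof (rule ccontr)
    assume bM: "b \<notin> M"
    have "M \<subseteq> conductor M a"
      using Ms a subspace_mult[OF Ms(1) a(1)] by (auto simp: conductor_def mult.commute)
    moreover have "b \<in> conductor M a"
      using b ab by (simp add: conductor_def mult.commute)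
    ultimately have ca: "conductor M a \<in> \<F>"
      using max[OF conductor_in_ideals[OF Ms(1)]] bM by blast
    let ?L = "K.span (insert a M)"
    have L: "?L \<in> ideals"
      using K.span_minimal[OF _ subspace_D, of "insert a M"] a Ms by (auto simp: ideals_def)
    have "M \<subseteq> ?L" "a \<in> ?L"
      using K.span_superset[of "insert a M"] by auto
    then have LF: "?L \<in> \<F>"
      using max[OF L] a by blast
    have "?L \<subseteq> {i. \<forall>d\<in>conductor M a. d * i \<in> M}"
    proof (rule K.span_minimal)
      show "insert a M \<subseteq> {i. \<forall>d\<in>conductor M a. d * i \<in> M}"
        using subspace_mult[OF Ms(1)] by (auto simp: conductor_def)
      show "K.subspace {i. \<forall>d\<in>conductor M a. d * i \<in> M}"
        using subspace_mult[OF Ms(1)] K.subspace_add[OF Ms(1)] K.subspace_0[OF Ms(1)]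
        by (intro subspaceI_mult) (auto simp: distrib_left mult.left_commute)
    qed
    then have sub: "conductor M a \<subseteq> conductor M i" if "i \<in> ?L" for i
      using that by (auto simp: conductor_def)
    have "M \<in> \<F>"
      by (rule LS_conductor[OF F' LF M(1)])
        (use sub LS_up[OF F' ca conductor_in_ideals[OF Ms(1)]] in blast)
    then show False
      using M by blast
  qed
  then have "M \<in> Spec"
    using M D_in_LS[OF F'] unfolding Spec_def by blast
  then show ?thesis
    using that M by blast
qed

lemma lambda_op_spectral:
  assumes F: "\<F> \<in> LS_f"
  shows "lambda_op \<F> = spectral_op {P \<in> Spec. P \<notin> \<F>}"
proof
  have F': "\<F> \<in> LS"
    using F LS_f_subset_LS by blast
  fix E show "lambda_op \<F> E = spectral_op {P \<in> Spec. P \<notin> \<F>} E"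
  proof (cases "E \<in> Fbar")
    case True
    have "conductor E x \<in> \<F> \<longleftrightarrow> (\<forall>P\<in>{P \<in> Spec. P \<notin> \<F>}. \<not> conductor E x \<subseteq> P)" for x
    proof
      show "conductor E x \<in> \<F> \<Longrightarrow> \<forall>P\<in>{P \<in> Spec. P \<notin> \<F>}. \<not> conductor E x \<subseteq> P"
        using LS_up[OF F'] by (auto simp: Spec_def)
      assume avoid: "\<forall>P\<in>{P \<in> Spec. P \<notin> \<F>}. \<not> conductor E x \<subseteq> P"
      show "conductor E x \<in> \<F>"
      proof (rule ccontr)
        assume "conductor E x \<notin> \<F>"
        then obtain P where "P \<in> Spec" "conductor E x \<subseteq> P" "P \<notin> \<F>"
          using prime_avoiding_LS_f[OF F conductor_in_ideals[OF Fbar_subspace[OF True]]] by metis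
        then show False
          using avoid by simp
      qed
    qed
    moreover have "{P \<in> Spec. P \<notin> \<F>} \<subseteq> Spec"
      by blast
    ultimately show ?thesis
      using True lambda_op_eq[OF F' True] spectral_op_eq[OF _ True] by simp
  qed (simp add: lambda_op_def spectral_op_def)
qed

lemma lambda_op_in_SStar_fsp:
  assumes F: "\<F> \<in> LS_f" shows "lambda_op \<F> \<in> SStar_fsp"
proof -
  have "\<exists>Y\<subseteq>Spec. lambda_op \<F> = spectral_op Y"
    using lambda_op_spectral[OF F] by (intro exI[of _ "{P \<in> Spec. P \<notin> \<F>}"]) auto
  moreover have "lambda_op \<F> \<in> SStar"
    using F LS_f_subset_LS by (intro lambda_op_SStar) (rule subsetD)
  ultimately show ?thesis
    using finite_type_lambda_op[OF F] by (simp add: SStar_fsp_def)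
qed


section \<open>The localizing system of a closure operation\<close>

text \<open>Only finitely generated ideals are tested, so that the system is of finite type for every \<open>s\<close>. For stable \<open>s\<close> of
  finite type it consists of all nonzero ideals with \<open>1\<close> in their closure.\<close>

definition fg_system :: "'a::idom operation \<Rightarrow> 'a fract set set"
  where "fg_system s = {I \<in> ideals. \<exists>J\<in>fg_ideals. J \<subseteq> I \<and> 1 \<in> s J}"

text \<open>The locale treats semistar operations (\<open>\<E>\<close> the nonzero submodules) and star operations (\<open>\<E>\<close> the
  fractional ideals) at once.\<close>

locale closure_operation =
  fixes \<E> :: "'a::idom fract set set" and s :: "'a operation"
  assumes ideals_subset: "ideals - {{0}} \<subseteq> \<E>"
    and subset_Fbar: "\<E> \<subseteq> Fbar"
    and scaled_mem: "E \<in> \<E> \<Longrightarrow> z \<noteq> 0 \<Longrightarrow> (\<lambda>x. z * x) ` E \<in> \<E>"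
    and closure: "s \<in> closure_operations \<E>"
begin

lemma mem_carrier: "E \<in> \<E> \<Longrightarrow> s E \<in> \<E>"
  and scaled: "z \<noteq> 0 \<Longrightarrow> E \<in> \<E> \<Longrightarrow> s ((\<lambda>x. z * x) ` E) = (\<lambda>x. z * x) ` s E"
  and mono: "E \<in> \<E> \<Longrightarrow> F \<in> \<E> \<Longrightarrow> E \<subseteq> F \<Longrightarrow> s E \<subseteq> s F"
  and extensive: "E \<in> \<E> \<Longrightarrow> E \<subseteq> s E"
  and idem: "E \<in> \<E> \<Longrightarrow> s (s E) = s E"
proof -
  note c = closure[unfolded closure_operations_def mem_Collect_eq]
  show "E \<in> \<E> \<Longrightarrow> s E \<in> \<E>"
    using c[THEN conjunct1] by (rule PiE_mem)
  show "z \<noteq> 0 \<Longrightarrow> E \<in> \<E> \<Longrightarrow> s ((\<lambda>x. z * x) ` E) = (\<lambda>x. z * x) ` s E"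
    using c[THEN conjunct2, THEN conjunct1] by metis
  show "E \<in> \<E> \<Longrightarrow> F \<in> \<E> \<Longrightarrow> E \<subseteq> F \<Longrightarrow> s E \<subseteq> s F"
    using c[THEN conjunct2, THEN conjunct2, THEN conjunct1] by metis
  show "E \<in> \<E> \<Longrightarrow> E \<subseteq> s E"
    using c[THEN conjunct2, THEN conjunct2, THEN conjunct2, THEN conjunct1] by metis
  show "E \<in> \<E> \<Longrightarrow> s (s E) = s E"
    using c[THEN conjunct2, THEN conjunct2, THEN conjunct2, THEN conjunct2] by metis
qed

lemma carrier_subspace: "E \<in> \<E> \<Longrightarrow> K.subspace E"
  using subset_Fbar Fbar_subspace by blast

lemma closure_subspace: "E \<in> \<E> \<Longrightarrow> K.subspace (s E)"
  using carrier_subspace mem_carrier by blast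

lemma ideal_mem: "I \<in> ideals \<Longrightarrow> I \<noteq> {0} \<Longrightarrow> I \<in> \<E>"
  using ideals_subset by blast

lemma fg_ideal_mem: "J \<in> fg_ideals \<Longrightarrow> J \<in> \<E>"
  using ideals_subset fg_ideals_subset_ideals by blast

lemma closure_eq_D_iff:
  assumes J: "J \<in> fg_ideals" shows "s J = s \<D> \<longleftrightarrow> 1 \<in> s J"
proof
  have D: "\<D> \<in> \<E>"
    using fg_ideal_mem D_in_fg_ideals by blast
  show "s J = s \<D> \<Longrightarrow> 1 \<in> s J"
    using extensive[OF D] one_in_D by auto
  assume "1 \<in> s J"
  then have "\<D> \<subseteq> s J"
    by (intro subspace_subset_D closure_subspace fg_ideal_mem J)
  then have "s \<D> \<subseteq> s J"
    using mono[OF D mem_carrier] idem fg_ideal_mem[OF J] by simp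
  moreover have "s J \<subseteq> s \<D>"
    using J by (intro mono fg_ideal_mem D) (auto simp: fg_ideals_def ideals_def)
  ultimately show "s J = s \<D>"
    by simp
qed

text \<open>Axiom (ii) of a localizing system is where the idempotence of the closure enters. It suffices
  to look at a finitely generated member \<open>J0 = (g\<^sub>1, \<dots>, g\<^sub>n)\<close>; if \<open>H\<^sub>i g\<^sub>i \<subseteq> J\<close> with \<open>1\<close> in the closure of \<open>H\<^sub>i\<close>,
  then the finitely generated ideal \<open>L = \<Sum>H\<^sub>i g\<^sub>i \<subseteq> J\<close> has a closure that contains every \<open>g\<^sub>i\<close>, hence \<open>J0\<close>,
  hence \<open>1\<close>.\<close>

lemma fg_system_conductor:
  assumes I: "I \<in> fg_system s" and J: "J \<in> ideals"
    and cond: "\<And>i. i \<in> I \<Longrightarrow> conductor J i \<in> fg_system s"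
  shows "J \<in> fg_system s"
proof -
  obtain J0 where J0: "J0 \<in> fg_ideals" "J0 \<subseteq> I" "1 \<in> s J0"
    using I by (auto simp: fg_system_def)
  then obtain G where G: "finite G" "J0 = K.span G"
    by (auto simp: fg_ideals_def fin_gen_def)
  have Gsub: "G \<subseteq> I" "G \<subseteq> J0"
    using G J0 K.span_superset by auto
  have "\<exists>B. finite B \<and> K.span B \<in> fg_ideals \<and> K.span B \<subseteq> conductor J g \<and> 1 \<in> s (K.span B)"
    if g: "g \<in> G" for g
  proof -
    obtain H where H: "H \<in> fg_ideals" "H \<subseteq> conductor J g" "1 \<in> s H"
      using cond[OF subsetD[OF Gsub(1) g]] by (auto simp: fg_system_def)
    then obtain B where "finite B" "H = K.span B"
      by (auto simp: fg_ideals_def fin_gen_def)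
    then show ?thesis
      using H by blast
  qed
  then obtain B where fin: "\<And>g. g \<in> G \<Longrightarrow> finite (B g)"
    and fg: "\<And>g. g \<in> G \<Longrightarrow> K.span (B g) \<in> fg_ideals"
    and sub: "\<And>g. g \<in> G \<Longrightarrow> K.span (B g) \<subseteq> conductor J g"
    and one: "\<And>g. g \<in> G \<Longrightarrow> 1 \<in> s (K.span (B g))"
    by metis
  define C where "C = (\<Union>g\<in>G. (\<lambda>x. g * x) ` B g)"
  have Js: "K.subspace J" "J \<subseteq> \<D>"
    using J by (auto simp: ideals_def)
  have "C \<subseteq> J"
    using sub K.span_superset by (fastforce simp: C_def conductor_def mult.commute)
  then have CJ: "K.span C \<subseteq> J"
    using K.span_minimal Js by blast
  have scC: "(\<lambda>x. g * x) ` K.span (B g) \<subseteq> K.span C" if "g \<in> G" for g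
    unfolding span_scaled[symmetric] using that by (intro K.span_mono) (auto simp: C_def)
  have "\<exists>g\<in>G. g \<noteq> 0"
  proof (rule ccontr)
    assume "\<not> (\<exists>g\<in>G. g \<noteq> 0)"
    then have "K.span G \<subseteq> {0}"
      by (intro K.span_minimal) (auto simp: K.subspace_0)
    then show False
      using G J0 K.span_zero[of G] by (auto simp: fg_ideals_def)
  qed
  then obtain g where g: "g \<in> G" "g \<noteq> 0"
    by blast
  obtain b where b: "b \<in> K.span (B g)" "b \<noteq> 0"
    using fg[OF g(1)] nonzero_element[OF K.subspace_span] by (auto simp: fg_ideals_def)
  have "g * b \<in> K.span C" "g * b \<noteq> 0"
    using scC[OF g(1)] b g by auto
  then have "K.span C \<noteq> {0}"
    by blast
  moreover have "finite C"
    using fin G by (auto simp: C_def)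
  ultimately have L: "K.span C \<in> fg_ideals"
    using CJ Js by (auto simp: fg_ideals_def ideals_def fin_gen_def)
  note L' = fg_ideal_mem[OF L]
  have "g \<in> s (K.span C)" if g: "g \<in> G" for g
  proof (cases "g = 0")
    case True
    then show ?thesis
      using K.subspace_0[OF closure_subspace[OF L']] by simp
  next
    case False
    note Bm = fg_ideal_mem[OF fg[OF g]]
    have "g * 1 \<in> (\<lambda>x. g * x) ` s (K.span (B g))"
      using one[OF g] by (rule imageI)
    also have "\<dots> = s ((\<lambda>x. g * x) ` K.span (B g))"
      using scaled[OF False Bm] by simp
    also have "\<dots> \<subseteq> s (K.span C)"
      by (rule mono[OF scaled_mem[OF Bm False] L' scC[OF g]])
    finally show ?thesis
      by simp
  qed
  then have "J0 \<subseteq> s (K.span C)"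
    unfolding G(2) by (intro K.span_minimal closure_subspace L') blast
  then have "s J0 \<subseteq> s (K.span C)"
    using mono[OF fg_ideal_mem[OF J0(1)] mem_carrier[OF L']] idem[OF L'] by simp
  then show ?thesis
    using J0 L CJ J by (auto simp: fg_system_def)
qed

lemma fg_system_LS_f: "fg_system s \<in> LS_f"
proof -
  have "fg_system s \<in> LS"
  proof (rule LSI)
    show "\<D> \<in> fg_system s"
      using D_in_ideals D_in_fg_ideals extensive[OF fg_ideal_mem[OF D_in_fg_ideals]] one_in_D
      unfolding fg_system_def by blast
    show "fg_system s \<subseteq> ideals - {{0}}"
    proof
      fix I assume "I \<in> fg_system s"
      then obtain J where J: "I \<in> ideals" "J \<in> fg_ideals" "J \<subseteq> I"
        by (auto simp: fg_system_def)
      then show "I \<in> ideals - {{0}}"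
        using nonzero_element[of J] by (auto simp: fg_ideals_def ideals_def)
    qed
    show "J \<in> fg_system s" if "I \<in> fg_system s" "J \<in> ideals" "I \<subseteq> J" for I J
      using that unfolding fg_system_def mem_Collect_eq by (meson order_trans)
    show "J \<in> fg_system s"
      if "I \<in> fg_system s" "J \<in> ideals" "\<And>i. i \<in> I \<Longrightarrow> conductor J i \<in> fg_system s" for I J
      using fg_system_conductor that .
  qed
  moreover have "\<exists>J\<in>fg_system s. J \<in> fg_ideals \<and> J \<subseteq> I" if I: "I \<in> fg_system s" for I
  proof -
    obtain J where J: "J \<in> fg_ideals" "J \<subseteq> I" "1 \<in> s J"
      using I by (auto simp: fg_system_def)
    then have "J \<in> fg_system s"
      by (auto simp: fg_system_def fg_ideals_def)
    then show ?thesis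
      using J by metis
  qed
  ultimately show ?thesis
    by (simp add: LS_f_def)
qed

lemma mem_lambda_op_fg_system_iff:
  assumes E: "E \<in> Fbar"
  shows "x \<in> lambda_op (fg_system s) E \<longleftrightarrow> (\<exists>J\<in>fg_ideals. J \<subseteq> conductor E x \<and> 1 \<in> s J)"
proof -
  have "fg_system s \<in> LS"
    using fg_system_LS_f LS_f_subset_LS by blast
  then show ?thesis
    using conductor_in_ideals[OF Fbar_subspace[OF E]] by (simp add: lambda_op_eq E fg_system_def)
qed

text \<open>For \<open>x \<noteq> 0\<close> in \<open>E\<^sup>\<star>\<close>, homogeneity gives \<open>1 \<in> (x\<inverse>E)\<^sup>\<star>\<close>, stability gives \<open>1 \<in> (D \<inter> x\<inverse>E)\<^sup>\<star>\<close>, and finite type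
  gives a finitely generated ideal \<open>J \<subseteq> D \<inter> x\<inverse>E\<close> with \<open>1 \<in> J\<^sup>\<star>\<close>; then \<open>J\<close> carries \<open>x\<close> into \<open>E\<close>.\<close>

lemma stable_finite_type_eq_lambda_op:
  assumes stable: "stable_on \<E> s" and fin: "finite_type_on \<E> s" and E: "E \<in> \<E>"
  shows "s E = lambda_op (fg_system s) E"
proof (rule set_eqI)
  fix x
  have EF: "E \<in> Fbar"
    using E subset_Fbar by blast
  have DE: "\<D> \<in> \<E>"
    using fg_ideal_mem[OF D_in_fg_ideals] .
  show "x \<in> s E \<longleftrightarrow> x \<in> lambda_op (fg_system s) E"
  proof (cases "x = 0")
    case True
    have "lambda_op (fg_system s) E \<in> Fbar"
      using lambda_op_Fbar[OF _ EF] fg_system_LS_f LS_f_subset_LS by blast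
    then show ?thesis
      using True K.subspace_0[OF closure_subspace[OF E]] K.subspace_0[OF Fbar_subspace] by blast
  next
    case False
    show ?thesis
      unfolding mem_lambda_op_fg_system_iff[OF EF]
    proof
      let ?I = "conductor E x" and ?E' = "(\<lambda>y. inverse x * y) ` E"
      have E': "?E' \<in> \<E>"
        using scaled_mem[OF E] False by simp
      have "d \<in> ?E' \<longleftrightarrow> d * x \<in> E" for d
        using False by (auto simp: image_iff field_simps intro!: bexI[of _ "d * x"])
      then have I: "?I = \<D> \<inter> ?E'"
        by (auto simp: conductor_def)
      assume "x \<in> s E"
      then have "inverse x * x \<in> s ?E'"
        using scaled[OF _ E, of "inverse x"] False by (metis imageI inverse_nonzero_iff_nonzero)
      then have "1 \<in> s \<D> \<inter> s ?E'"
        using False extensive[OF DE] one_in_D by auto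
      then have "1 \<in> s ?I"
        using stable DE E' unfolding I stable_on_def by simp
      moreover have "?I \<in> \<E>"
        using ideal_mem[OF conductor_in_ideals[OF carrier_subspace[OF E]] conductor_nonzero[OF EF]] .
      ultimately obtain J where J: "1 \<in> s J" "J \<subseteq> ?I" "J \<in> fg_fractional_ideals"
        using fin unfolding finite_type_on_def by blast
      then have "J \<in> fg_ideals"
        using conductor_subset_D by (auto simp: fg_ideals_iff)
      then show "\<exists>J\<in>fg_ideals. J \<subseteq> ?I \<and> 1 \<in> s J"
        using J by blast
    next
      assume "\<exists>J\<in>fg_ideals. J \<subseteq> conductor E x \<and> 1 \<in> s J"
      then obtain J where J: "J \<in> fg_ideals" "J \<subseteq> conductor E x" "1 \<in> s J"
        by blast
      note Jm = fg_ideal_mem[OF J(1)]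
      have "x * 1 \<in> (\<lambda>y. x * y) ` s J"
        using J by blast
      also have "\<dots> = s ((\<lambda>y. x * y) ` J)"
        using scaled[OF False Jm] by simp
      also have "\<dots> \<subseteq> s E"
        using J(2) by (intro mono scaled_mem Jm E False) (auto simp: conductor_def mult.commute)
      finally show "x \<in> s E"
        by simp
    qed
  qed
qed

end

lemma closure_operation_SStar: "s \<in> SStar \<Longrightarrow> closure_operation Fbar s"
  unfolding SStar_def using ideals_subset_Fbar order_refl Fbar_scaled by (rule closure_operation.intro)

lemma fractional_ideals_subset_Fbar: "fractional_ideals \<subseteq> Fbar"
  by (auto simp: fractional_ideals_def)

lemma closure_operation_Star:
  assumes "s \<in> Star" shows "closure_operation fractional_ideals s"
proof (rule closure_operation.intro)
  show "s \<in> closure_operations fractional_ideals"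
    using assms unfolding Star_def by blast
qed (fact ideals_subset_fractional_ideals fractional_ideals_subset_Fbar fractional_ideals_scaled)+

lemma SStar_extensional: "s \<in> SStar \<Longrightarrow> E \<notin> Fbar \<Longrightarrow> s E = undefined"
  by (auto simp: SStar_def closure_operations_def)

lemma SStar_eqI: "s \<in> SStar \<Longrightarrow> t \<in> SStar \<Longrightarrow> (\<And>E. E \<in> Fbar \<Longrightarrow> s E = t E) \<Longrightarrow> s = t"
  by (rule ext) (metis SStar_extensional)

lemma tilde_eq_lambda_op:
  fixes s :: "'a::idom operation"
  assumes s: "s \<in> SStar" shows "tilde s = lambda_op (fg_system s)"
proof
  interpret closure_operation Fbar s
    using closure_operation_SStar[OF s] .
  fix E show "tilde s E = lambda_op (fg_system s) E"
  proof (cases "E \<in> Fbar")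
    case True
    show ?thesis
    proof (rule set_eqI)
      fix x
      have "x \<in> tilde s E \<longleftrightarrow> (\<exists>J\<in>fg_ideals. x \<in> colon E J \<and> s J = s \<D>)"
        using True by (auto simp: tilde_def)
      also have "\<dots> \<longleftrightarrow> (\<exists>J\<in>fg_ideals. J \<subseteq> conductor E x \<and> 1 \<in> s J)"
      proof (rule bex_cong[OF refl])
        fix J :: "'a fract set" assume J: "J \<in> fg_ideals"
        then have "J \<subseteq> \<D>"
          by (simp add: fg_ideals_def ideals_def)
        then show "x \<in> colon E J \<and> s J = s \<D> \<longleftrightarrow> J \<subseteq> conductor E x \<and> 1 \<in> s J"
          by (simp add: closure_eq_D_iff[OF J] mem_colon_iff)
      qed
      finally show "x \<in> tilde s E \<longleftrightarrow> x \<in> lambda_op (fg_system s) E"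
        by (simp add: mem_lambda_op_fg_system_iff[OF True])
    qed
  qed (simp add: tilde_def lambda_op_def)
qed

lemma fg_system_lambda_op_LS:
  assumes F: "\<F> \<in> LS" shows "fg_system (lambda_op \<F>) = {I \<in> ideals. \<exists>J\<in>fg_ideals. J \<subseteq> I \<and> J \<in> \<F>}"
proof -
  have "1 \<in> lambda_op \<F> J \<longleftrightarrow> J \<in> \<F>" if "J \<in> fg_ideals" for J
    by (rule one_in_lambda_op_iff[OF F subsetD[OF fg_ideals_subset_ideals that]])
  then show ?thesis
    unfolding fg_system_def by blast
qed

lemma fg_system_lambda_op:
  assumes F: "\<F> \<in> LS_f" shows "fg_system (lambda_op \<F>) = \<F>"
proof -
  have F': "\<F> \<in> LS"
    using F LS_f_subset_LS by blast
  have "I \<in> \<F> \<longleftrightarrow> I \<in> ideals \<and> (\<exists>J\<in>fg_ideals. J \<subseteq> I \<and> J \<in> \<F>)" for I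
    using F LS_up[OF F'] LS_D[OF F'] unfolding LS_f_def by blast
  then show ?thesis
    unfolding fg_system_lambda_op_LS[OF F'] by blast
qed

lemma fg_system_in_LS_f: "s \<in> SStar \<Longrightarrow> fg_system s \<in> LS_f"
  using closure_operation.fg_system_LS_f[OF closure_operation_SStar] .

lemma lambda_op_fg_system:
  assumes s: "s \<in> SStar" and "stable_on Fbar s" "finite_type_on Fbar s"
  shows "lambda_op (fg_system s) = s"
proof (rule SStar_eqI[OF _ s])
  show "lambda_op (fg_system s) \<in> SStar"
    using lambda_op_SStar fg_system_in_LS_f[OF s] LS_f_subset_LS by blast
  show "lambda_op (fg_system s) E = s E" if "E \<in> Fbar" for E
    using closure_operation.stable_finite_type_eq_lambda_op[OF closure_operation_SStar[OF s]] assms that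
    by simp
qed

lemma SStar_fsp_D:
  assumes "s \<in> SStar_fsp"
  shows "s \<in> SStar" "fg_system s \<in> LS_f" "lambda_op (fg_system s) = s"
  using assms lambda_op_fg_system[of s] stable_spectral_op fg_system_in_LS_f
  by (auto simp: SStar_fsp_def)

lemma tilde_in_SStar_fsp: "s \<in> SStar \<Longrightarrow> tilde s \<in> SStar_fsp"
  by (simp add: tilde_eq_lambda_op lambda_op_in_SStar_fsp fg_system_in_LS_f)

lemma tilde_SStar_fsp: "s \<in> SStar_fsp \<Longrightarrow> tilde s = s"
  by (simp add: tilde_eq_lambda_op SStar_fsp_D)

lemma mem_V_fg_iff:
  assumes s: "s \<in> SStar" and J: "J \<in> fg_ideals"
  shows "s \<in> V J \<longleftrightarrow> J \<in> fg_system s"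
proof -
  interpret closure_operation Fbar s
    using closure_operation_SStar[OF s] .
  have "1 \<in> s J" if "J' \<in> fg_ideals" "J' \<subseteq> J" "1 \<in> s J'" for J'
    using mono[OF fg_ideal_mem fg_ideal_mem] that J by blast
  then show ?thesis
    using s J fg_ideals_subset_ideals by (auto simp: V_def fg_system_def)
qed

lemma mem_V_SStar_fsp_iff:
  assumes s: "s \<in> SStar_fsp" and I: "I \<in> ideals" "I \<noteq> {0}"
  shows "s \<in> V I \<longleftrightarrow> I \<in> fg_system s"
  using one_in_lambda_op_iff[of "fg_system s" I] SStar_fsp_D[OF s] LS_f_subset_LS I
  by (auto simp: V_def)

lemma tilde_mem_V_iff:
  assumes s: "s \<in> SStar" and J: "J \<in> fg_ideals"
  shows "tilde s \<in> V J \<longleftrightarrow> s \<in> V J"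
proof -
  have "fg_system (tilde s) = fg_system s"
    using s by (simp add: tilde_eq_lambda_op fg_system_lambda_op fg_system_in_LS_f)
  moreover have "tilde s \<in> SStar"
    using SStar_fsp_D tilde_in_SStar_fsp[OF s] by blast
  ultimately show ?thesis
    by (simp add: mem_V_fg_iff s J)
qed

text \<open>A finitely generated ideal \<open>J\<close> lies in a least localizing system of finite type. The intersection of all
  such systems is a localizing system, and its finitely generated members generate one of finite type.\<close>

lemma least_LS_f:
  fixes J :: "'a::idom fract set"
  assumes J: "J \<in> fg_ideals"
  obtains \<F>\<^sub>0 where "\<F>\<^sub>0 \<in> LS_f" "J \<in> \<F>\<^sub>0" "\<And>\<F>. \<F> \<in> LS_f \<Longrightarrow> J \<in> \<F> \<Longrightarrow> \<F>\<^sub>0 \<subseteq> \<F>"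
proof -
  define G where "G = {I \<in> ideals - {{0}}. \<forall>\<F>\<in>LS_f. J \<in> \<F> \<longrightarrow> I \<in> \<F>}"
  have LS: "\<F> \<in> LS" if "\<F> \<in> LS_f" for \<F> :: "'a fract set set"
    using that LS_f_subset_LS by blast
  have G: "G \<in> LS"
  proof (rule LSI)
    show "\<D> \<in> G"
      using D_in_LS[OF LS] D_in_ideals D_nonzero by (simp add: G_def)
    show "G \<subseteq> ideals - {{0}}"
      by (auto simp: G_def)
  next
    fix I L assume IL: "I \<in> G" "L \<in> ideals" "I \<subseteq> L"
    have "L \<in> \<F>" if "\<F> \<in> LS_f" "J \<in> \<F>" for \<F>
      using LS_up[OF LS[OF that(1)] _ IL(2,3)] IL(1) that by (simp add: G_def)
    moreover have "L \<noteq> {0}"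
      using IL nonzero_element[of I] by (auto simp: G_def ideals_def)
    ultimately show "L \<in> G"
      using IL by (simp add: G_def)
  next
    fix I L assume IL: "I \<in> G" "L \<in> ideals" and cond: "\<And>i. i \<in> I \<Longrightarrow> conductor L i \<in> G"
    have "L \<in> \<F>" if "\<F> \<in> LS_f" "J \<in> \<F>" for \<F>
      using LS_conductor[OF LS[OF that(1)] _ IL(2), of I] IL(1) cond that by (simp add: G_def)
    moreover have "L \<noteq> {0}"
    proof -
      obtain i where i: "i \<in> I" "i \<noteq> 0"
        using IL nonzero_element[of I] by (auto simp: G_def ideals_def)
      then obtain d where "d \<in> conductor L i" "d \<noteq> 0"
        using cond[OF i(1)] nonzero_element[of "conductor L i"] by (auto simp: G_def ideals_def)
      then have "d * i \<in> L" "d * i \<noteq> 0"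
        using i by (auto simp: conductor_def)
      then show ?thesis
        by blast
    qed
    ultimately show "L \<in> G"
      using IL by (simp add: G_def)
  qed
  let ?F = "fg_system (lambda_op G)"
  have F: "?F = {I \<in> ideals. \<exists>J\<in>fg_ideals. J \<subseteq> I \<and> J \<in> G}"
    using fg_system_lambda_op_LS[OF G] .
  show ?thesis
  proof (rule that)
    show "?F \<in> LS_f"
      using fg_system_in_LS_f lambda_op_SStar[OF G] by blast
    show "J \<in> ?F"
    proof -
      have "J \<in> ideals" "J \<in> G"
        using J by (simp_all add: G_def fg_ideals_def)
      then show ?thesis
        using J unfolding F by blast
    qed
    show "?F \<subseteq> \<F>" if "\<F> \<in> LS_f" "J \<in> \<F>" for \<F>
    proof
      fix I assume "I \<in> ?F"
      then obtain J' where "I \<in> ideals" "J' \<subseteq> I" "J' \<in> G"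
        unfolding F by blast
      then show "I \<in> \<F>"
        using LS_up[OF LS[OF that(1)], of J' I] that by (simp add: G_def)
    qed
  qed
qed


section \<open>The topologies\<close>

lemma continuous_map_generated:
  assumes "f \<in> topspace X \<rightarrow> \<Union>\<B>" "\<And>B. B \<in> \<B> \<Longrightarrow> openin X {x \<in> topspace X. f x \<in> B}"
  shows "continuous_map X (topology_generated_by \<B>) f"
proof (rule continuous_on_generated_topo)
  show "f ` topspace X \<subseteq> \<Union>\<B>"
    using assms(1) by blast
  show "openin X (f -` B \<inter> topspace X)" if "B \<in> \<B>" for B
    using assms(2)[OF that] by (simp add: vimage_def Int_def conj_commute)
qed

text \<open>If \<open>1 \<in> E\<^sup>\<star>\<close>, then \<open>(E :\<^sub>D 1) = E \<inter> D\<close> is in the system of \<open>\<star>\<close>, hence so is a finitely generated ideal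
  \<open>J \<subseteq> E\<close>.\<close>

lemma V_Int_SStar_fsp:
  fixes E :: "'a::idom fract set"
  assumes E: "E \<in> Fbar"
  shows "V E \<inter> SStar_fsp = \<Union>{V J \<inter> SStar_fsp | J. J \<in> fg_ideals \<and> J \<subseteq> E}"
proof (rule set_eqI)
  fix s :: "'a operation"
  have "1 \<in> s E \<longleftrightarrow> (\<exists>J\<in>fg_ideals. J \<subseteq> E \<and> s \<in> V J)" if s: "s \<in> SStar_fsp"
  proof -
    note D = SStar_fsp_D[OF s]
    have "1 \<in> s E \<longleftrightarrow> conductor E 1 \<in> fg_system s"
      using lambda_op_eq[OF _ E, of "fg_system s"] D LS_f_subset_LS by auto
    also have "\<dots> \<longleftrightarrow> (\<exists>J\<in>fg_ideals. J \<subseteq> E \<and> s \<in> V J)"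
      using conductor_in_ideals[OF Fbar_subspace[OF E], of 1] D(1)
      by (auto simp: fg_system_def conductor_def V_def fg_ideals_def ideals_def)
    finally show ?thesis .
  qed
  then show "s \<in> V E \<inter> SStar_fsp \<longleftrightarrow> s \<in> \<Union>{V J \<inter> SStar_fsp | J. J \<in> fg_ideals \<and> J \<subseteq> E}"
    by (auto simp: V_def SStar_fsp_def)
qed

lemma SStar_fsp_subset: "SStar_fsp \<subseteq> SStar"
  by (auto simp: SStar_fsp_def)

lemma topspace_zariski_fsp: "topspace zariski_fsp = SStar_fsp"
  using SStar_fsp_subset by (auto simp: zariski_fsp_def topspace_zariski_SStar)

lemma fg_ideals_subset_Fbar: "fg_ideals \<subseteq> Fbar"
  using fg_ideals_subset_ideals ideals_subset_Fbar by blast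

lemma openin_zariski_fsp_V: "E \<in> Fbar \<Longrightarrow> openin zariski_fsp (V E \<inter> SStar_fsp)"
  unfolding zariski_fsp_def zariski_SStar_def
  by (intro openin_subtopology_Int topology_generated_by_Basis) blast

lemma Union_V_Fbar: "\<Union>{V E |E. E \<in> Fbar} = SStar"
  using topspace_zariski_SStar unfolding zariski_SStar_def topology_generated_by_topspace .

lemma Union_V_fg_ideals: "\<Union>{V J |J. J \<in> fg_ideals} = SStar"
  using topspace_fg_topology_SStar unfolding fg_topology_SStar_def topology_generated_by_topspace .

lemma Union_V_Int_SStar_fsp: "\<Union>{V J \<inter> SStar_fsp |J. J \<in> fg_ideals} = SStar_fsp"
  using V_D D_in_fg_ideals SStar_fsp_subset by blast

lemma topology_eqI_continuous_id:
  assumes "continuous_map X Y id" "continuous_map Y X id" shows "X = Y"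
proof -
  have imp: "openin Y U" if XY: "continuous_map X Y id" and YX: "continuous_map Y X id" and U: "openin X U"
    for X Y :: "'b topology" and U
  proof -
    have "U \<subseteq> topspace Y"
      using openin_subset[OF U] XY by (auto simp: continuous_map_def)
    then have "{y \<in> topspace Y. id y \<in> U} = U"
      by auto
    then show ?thesis
      using openin_continuous_map_preimage[OF YX U] by simp
  qed
  show ?thesis
    unfolding topology_eq using imp[of X Y] imp[of Y X] assms by blast
qed

lemma zariski_fsp_eq:
  "(zariski_fsp :: 'a::idom operation topology) = topology_generated_by {V J \<inter> SStar_fsp | J. J \<in> fg_ideals}"
  (is "_ = topology_generated_by ?B")
proof -
  note top = Union_V_Int_SStar_fsp
  have open_V: "openin (topology_generated_by ?B) (V E \<inter> SStar_fsp)" if "E \<in> Fbar" for E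
    unfolding V_Int_SStar_fsp[OF that]
    by (intro openin_Union topology_generated_by_Basis) auto
  have "continuous_map (topology_generated_by ?B) zariski_SStar id"
    unfolding zariski_SStar_def
  proof (rule continuous_map_generated)
    show "id \<in> topspace (topology_generated_by ?B) \<rightarrow> \<Union>{V E |E. E \<in> Fbar}"
      unfolding Union_V_Fbar by (auto simp: top subsetD[OF SStar_fsp_subset])
    show "openin (topology_generated_by ?B) {x \<in> topspace (topology_generated_by ?B). id x \<in> A}"
      if A: "A \<in> {V E |E. E \<in> Fbar}" for A
    proof -
      obtain E where E: "E \<in> Fbar" "A = V E"
        using A by blast
      then have "{x \<in> topspace (topology_generated_by ?B). id x \<in> A} = V E \<inter> SStar_fsp"
        unfolding topology_generated_by_topspace top by auto
      then show ?thesis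
        using open_V[OF E(1)] by simp
    qed
  qed
  then have "continuous_map (topology_generated_by ?B) zariski_fsp id"
    unfolding zariski_fsp_def by (auto simp: continuous_map_in_subtopology top)
  moreover have "continuous_map zariski_fsp (topology_generated_by ?B) id"
  proof (rule continuous_map_generated)
    show "id \<in> topspace zariski_fsp \<rightarrow> \<Union>?B"
      by (simp add: top topspace_zariski_fsp)
    show "openin zariski_fsp {x \<in> topspace zariski_fsp. id x \<in> A}" if "A \<in> ?B" for A
    proof -
      have "{x \<in> topspace zariski_fsp. id x \<in> A} = A"
        using that by (auto simp: topspace_zariski_fsp)
      then show ?thesis
        using that openin_zariski_fsp_V fg_ideals_subset_Fbar by auto
    qed
  qed
  ultimately show ?thesis
    using topology_eqI_continuous_id by blast
qed

lemma generate_topology_on_upclosed: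
  assumes "generate_topology_on \<B> U" "x \<in> U" "\<And>B. B \<in> \<B> \<Longrightarrow> x \<in> B \<Longrightarrow> y \<in> B"
  shows "y \<in> U"
  using assms by (induction rule: generate_topology_on.induct) auto

text \<open>The operation of the least localizing system of finite type that contains \<open>J\<close> is a point of \<open>V J\<close> all of whose
  neighbourhoods contain the whole of \<open>V J\<close> within the spectral operations of finite type. So one member of
  any open cover is enough.\<close>

lemma compactin_V:
  assumes J: "J \<in> fg_ideals"
  shows "compactin zariski_fsp (V J \<inter> SStar_fsp)"
proof -
  obtain \<F>\<^sub>0 where F0: "\<F>\<^sub>0 \<in> LS_f" "J \<in> \<F>\<^sub>0" and least: "\<And>\<F>. \<F> \<in> LS_f \<Longrightarrow> J \<in> \<F> \<Longrightarrow> \<F>\<^sub>0 \<subseteq> \<F>"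
    using least_LS_f[OF J] by blast
  let ?m = "lambda_op \<F>\<^sub>0"
  have m: "?m \<in> SStar_fsp" "fg_system ?m = \<F>\<^sub>0"
    by (simp_all add: F0 lambda_op_in_SStar_fsp fg_system_lambda_op)
  have iff: "s \<in> V I \<longleftrightarrow> I \<in> fg_system s" if "s \<in> SStar_fsp" "I \<in> fg_ideals" for s and I :: "'a fract set"
    using mem_V_fg_iff SStar_fsp_D that by blast
  have mJ: "?m \<in> V J \<inter> SStar_fsp"
    using m F0 iff[OF m(1) J] by simp
  have nbhd: "V J \<inter> SStar_fsp \<subseteq> U" if U: "openin zariski_fsp U" "?m \<in> U" for U
  proof
    fix s assume s: "s \<in> V J \<inter> SStar_fsp"
    then have "\<F>\<^sub>0 \<subseteq> fg_system s"
      using least SStar_fsp_D iff J by blast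
    then have "s \<in> B" if "B \<in> {V J \<inter> SStar_fsp |J. J \<in> fg_ideals}" "?m \<in> B" for B
      using that iff m s by blast
    then show "s \<in> U"
      using generate_topology_on_upclosed[of "{V J \<inter> SStar_fsp |J. J \<in> fg_ideals}" U ?m s] U
      unfolding zariski_fsp_eq openin_topology_generated_by_iff by blast
  qed
  show ?thesis
    unfolding compactin_def
  proof (intro conjI allI impI)
    show "V J \<inter> SStar_fsp \<subseteq> topspace zariski_fsp"
      by (simp add: topspace_zariski_fsp)
    fix \<U> assume U: "Ball \<U> (openin zariski_fsp) \<and> V J \<inter> SStar_fsp \<subseteq> \<Union>\<U>"
    then obtain U where "U \<in> \<U>" "?m \<in> U"
      using mJ by blast
    then have "finite {U}" "{U} \<subseteq> \<U>" "V J \<inter> SStar_fsp \<subseteq> \<Union>{U}"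
      using nbhd U by auto
    then show "\<exists>\<G>. finite \<G> \<and> \<G> \<subseteq> \<U> \<and> V J \<inter> SStar_fsp \<subseteq> \<Union>\<G>"
      by blast
  qed
qed

lemma t0_space_zariski_fsp: "t0_space (zariski_fsp :: 'a::idom operation topology)"
  unfolding t0_space_def
proof (intro ballI impI)
  fix s t :: "'a operation"
  assume "s \<in> topspace zariski_fsp" "t \<in> topspace zariski_fsp" and ne: "s \<noteq> t"
  then have st: "s \<in> SStar_fsp" "t \<in> SStar_fsp"
    by (simp_all add: topspace_zariski_fsp)
  have "\<exists>J\<in>fg_ideals. \<not> (s \<in> V J \<longleftrightarrow> t \<in> V J)"
  proof (rule ccontr)
    assume "\<not> ?thesis"
    then have "1 \<in> s J \<longleftrightarrow> 1 \<in> t J" if "J \<in> fg_ideals" for J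
      using that st SStar_fsp_D(1) by (auto simp: V_def)
    then have "fg_system s = fg_system t"
      by (auto simp: fg_system_def)
    then show False
      using st ne SStar_fsp_D(3) by metis
  qed
  then obtain J where J: "J \<in> fg_ideals" "\<not> (s \<in> V J \<longleftrightarrow> t \<in> V J)"
    by blast
  then have "openin zariski_fsp (V J \<inter> SStar_fsp)" "\<not> (s \<in> V J \<inter> SStar_fsp \<longleftrightarrow> t \<in> V J \<inter> SStar_fsp)"
    using st openin_zariski_fsp_V fg_ideals_subset_Fbar by auto
  then show "\<exists>U. openin zariski_fsp U \<and> (s \<notin> U) = (t \<in> U)"
    by blast
qed

text \<open>The preimage of \<open>V J\<close> under \<open>tilde\<close> is \<open>V J\<close> itself. The statement leaves the topology open, since it serves both
  the Zariski topology and the coarser one generated by the \<open>V J\<close>.\<close>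

lemma continuous_map_tilde:
  assumes top: "topspace X = SStar" and op: "\<And>J. J \<in> fg_ideals \<Longrightarrow> openin X (V J)"
  shows "continuous_map X zariski_fsp tilde"
  unfolding zariski_fsp_eq
proof (rule continuous_map_generated)
  show "tilde \<in> topspace X \<rightarrow> \<Union>{V J \<inter> SStar_fsp |J. J \<in> fg_ideals}"
    unfolding Union_V_Int_SStar_fsp top by (simp add: tilde_in_SStar_fsp)
  fix B :: "'a operation set" assume "B \<in> {V J \<inter> SStar_fsp |J. J \<in> fg_ideals}"
  then obtain J :: "'a fract set" where J: "J \<in> fg_ideals" "B = V J \<inter> SStar_fsp"
    by blast
  have "tilde s \<in> B \<longleftrightarrow> s \<in> V J" if "s \<in> SStar" for s
    using that by (simp add: J tilde_mem_V_iff tilde_in_SStar_fsp)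
  moreover have "V J \<subseteq> SStar"
    by (auto simp: V_def)
  ultimately have "{s \<in> topspace X. tilde s \<in> B} = V J"
    unfolding top by blast
  then show "openin X {s \<in> topspace X. tilde s \<in> B}"
    using op J by simp
qed

lemma openin_zariski_SStar_V: "E \<in> Fbar \<Longrightarrow> openin zariski_SStar (V E)"
  unfolding zariski_SStar_def by (intro topology_generated_by_Basis) blast

lemma openin_fg_topology_V: "J \<in> fg_ideals \<Longrightarrow> openin fg_topology_SStar (V J)"
  unfolding fg_topology_SStar_def by (intro topology_generated_by_Basis) blast

lemma retraction_tilde: "retraction_maps zariski_SStar zariski_fsp tilde id"
  unfolding retraction_maps_def
proof (intro conjI ballI)
  show "continuous_map zariski_SStar zariski_fsp tilde"
    using fg_ideals_subset_Fbar
    by (intro continuous_map_tilde topspace_zariski_SStar openin_zariski_SStar_V) blast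
  show "continuous_map zariski_fsp zariski_SStar id"
    unfolding zariski_fsp_def id_def by (intro continuous_map_from_subtopology continuous_map_id[unfolded id_def])
  show "tilde (id s) = s" if "s \<in> topspace zariski_fsp" for s
    using that by (simp add: topspace_zariski_fsp tilde_SStar_fsp)
qed

text \<open>A continuous map onto a \<open>T\<^sub>0\<close> space with a continuous section is the Kolmogorov quotient map as soon as
  the section picks a point indistinguishable from the given one.\<close>

lemma canonical_Kolmogorov_map_section:
  assumes f: "continuous_map X Y f" and g: "continuous_map Y X g" and T0: "t0_space Y"
    and fg: "\<And>y. y \<in> topspace Y \<Longrightarrow> f (g y) = y"
    and gf: "\<And>x U. x \<in> topspace X \<Longrightarrow> openin X U \<Longrightarrow> g (f x) \<in> U \<longleftrightarrow> x \<in> U"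
  shows "canonical_Kolmogorov_map X Y f"
proof -
  let ?q = "Kolmogorov_quotient X"
  have fq: "f (?q x) = f x" if "x \<in> topspace X" for x
    using Kolmogorov_quotient_continuous_map[OF f T0 that] .
  have gt: "g y \<in> topspace X" if "y \<in> topspace Y" for y
    using g that by (auto simp: continuous_map_def)
  have qg: "?q (g (f x)) = ?q x" if "x \<in> topspace X" for x
    using gf[OF that] by (auto simp: Kolmogorov_quotient_eq)
  have top: "topspace (subtopology X (?q ` topspace X)) = ?q ` topspace X"
    by (auto simp: Kolmogorov_quotient_in_topspace)
  have "homeomorphic_maps (subtopology X (?q ` topspace X)) Y f (?q \<circ> g)"
    unfolding homeomorphic_maps_def top
  proof (intro conjI ballI)
    show "continuous_map (subtopology X (?q ` topspace X)) Y f"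
      using f by (rule continuous_map_from_subtopology)
    show "continuous_map Y (subtopology X (?q ` topspace X)) (?q \<circ> g)"
      using continuous_map_compose[OF g continuous_map_Kolmogorov_quotient] gt
      by (auto simp: continuous_map_in_subtopology)
    show "(?q \<circ> g) (f x) = x" if "x \<in> ?q ` topspace X" for x
      using that by (auto simp: fq qg)
    show "f ((?q \<circ> g) y) = y" if "y \<in> topspace Y" for y
      using that by (simp add: fq gt fg)
  qed
  then have "homeomorphic_map (subtopology X (?q ` topspace X)) Y f"
    by (rule homeomorphic_maps_imp_map)
  then show ?thesis
    unfolding canonical_Kolmogorov_map_def using fq by metis
qed

lemma canonical_Kolmogorov_map_tilde:
  "canonical_Kolmogorov_map (fg_topology_SStar :: 'a::idom operation topology) zariski_fsp tilde"
proof (rule canonical_Kolmogorov_map_section)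
  show "continuous_map fg_topology_SStar zariski_fsp tilde"
    by (intro continuous_map_tilde topspace_fg_topology_SStar openin_fg_topology_V)
  show "continuous_map zariski_fsp fg_topology_SStar id"
    unfolding fg_topology_SStar_def
  proof (rule continuous_map_generated)
    show "id \<in> topspace zariski_fsp \<rightarrow> \<Union>{V J |J. J \<in> fg_ideals}"
      unfolding Union_V_fg_ideals by (auto simp: topspace_zariski_fsp subsetD[OF SStar_fsp_subset])
    show "openin zariski_fsp {s \<in> topspace zariski_fsp. id s \<in> B}" if B: "B \<in> {V J |J. J \<in> fg_ideals}" for B
    proof -
      obtain J where J: "J \<in> fg_ideals" "B = V J"
        using B by blast
      then have "{s \<in> topspace zariski_fsp. id s \<in> B} = V J \<inter> SStar_fsp"
        unfolding topspace_zariski_fsp by auto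
      then show ?thesis
        using openin_zariski_fsp_V[of J] subsetD[OF fg_ideals_subset_Fbar J(1)] by simp
    qed
  qed
  show "t0_space zariski_fsp"
    by (rule t0_space_zariski_fsp)
  show "tilde (id s) = s" if "s \<in> topspace zariski_fsp" for s
    using that by (simp add: topspace_zariski_fsp tilde_SStar_fsp)
  fix s :: "'a operation" and U :: "'a operation set"
  assume s: "s \<in> topspace fg_topology_SStar" and "openin fg_topology_SStar U"
  then have U: "generate_topology_on {V J |J. J \<in> fg_ideals} U"
    by (simp add: fg_topology_SStar_def openin_topology_generated_by_iff)
  have "tilde s \<in> B \<longleftrightarrow> s \<in> B" if "B \<in> {V J |J. J \<in> fg_ideals}" for B
    using that s by (auto simp: tilde_mem_V_iff topspace_fg_topology_SStar)
  then show "id (tilde s) \<in> U \<longleftrightarrow> s \<in> U"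
    using generate_topology_on_upclosed[OF U, of s "tilde s"] generate_topology_on_upclosed[OF U, of "tilde s" s]
    unfolding id_apply by blast
qed


section \<open>Extension of star operations\<close>

text \<open>The extension is the operation of \<open>fg_system st\<close>. It is the only one because the system of an extension
  involves only its values at finitely generated ideals, where it agrees with \<open>st\<close>.\<close>

lemma unique_semistar_extension:
  assumes st: "st \<in> Star" and stable: "stable_on fractional_ideals st"
    and fin: "finite_type_on fractional_ideals st"
  shows "\<exists>!s. s \<in> SStar \<and> stable_on Fbar s \<and> finite_type_on Fbar s \<and> restrict s fractional_ideals = st"
proof (rule ex1I)
  interpret closure_operation fractional_ideals st
    using closure_operation_Star[OF st] .
  let ?s = "lambda_op (fg_system st)"
  have LS: "fg_system st \<in> LS"
    using fg_system_LS_f LS_f_subset_LS by blast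
  have "restrict ?s fractional_ideals = st"
  proof
    fix E show "restrict ?s fractional_ideals E = st E"
    proof (cases "E \<in> fractional_ideals")
      case True
      then show ?thesis
        using stable_finite_type_eq_lambda_op[OF stable fin] by simp
    next
      case False
      then show ?thesis
        using closure by (auto simp: closure_operations_def)
    qed
  qed
  then show "?s \<in> SStar \<and> stable_on Fbar ?s \<and> finite_type_on Fbar ?s \<and> restrict ?s fractional_ideals = st"
    using lambda_op_SStar[OF LS] stable_lambda_op[OF LS] finite_type_lambda_op[OF fg_system_LS_f] by blast
  fix s assume s: "s \<in> SStar \<and> stable_on Fbar s \<and> finite_type_on Fbar s \<and> restrict s fractional_ideals = st"
  then have "s J = st J" if "J \<in> fg_ideals" for J
    using that fg_ideals_subset_ideals ideals_subset_fractional_ideals by auto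
  then have "fg_system s = fg_system st"
    by (auto simp: fg_system_def)
  then show "s = ?s"
    using lambda_op_fg_system s by metis
qed


section \<open>Localizing systems and operations\<close>

lemma topspace_zariski_LS_f: "topspace zariski_LS_f = LS_f"
  using LS_f_subset_LS by (auto simp: zariski_LS_f_def topspace_zariski_LS)

lemma openin_zariski_LS_f_W: "I \<in> ideals \<Longrightarrow> openin zariski_LS_f (W I \<inter> LS_f)"
  unfolding zariski_LS_f_def zariski_LS_def
  by (intro openin_subtopology_Int topology_generated_by_Basis) blast

lemma homeomorphic_lambda_op: "homeomorphic_map zariski_LS_f (zariski_fsp :: 'a::idom operation topology) lambda_op"
proof (rule homeomorphic_maps_imp_map)
  show "homeomorphic_maps zariski_LS_f (zariski_fsp :: 'a operation topology) lambda_op fg_system"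
    unfolding homeomorphic_maps_def topspace_zariski_LS_f topspace_zariski_fsp
  proof (intro conjI ballI)
    show "continuous_map zariski_LS_f (zariski_fsp :: 'a operation topology) lambda_op"
      unfolding zariski_fsp_eq
    proof (rule continuous_map_generated)
      show "lambda_op \<in> topspace zariski_LS_f \<rightarrow> \<Union>{V J \<inter> SStar_fsp |J. J \<in> (fg_ideals :: 'a fract set set)}"
        unfolding Union_V_Int_SStar_fsp topspace_zariski_LS_f by (simp add: lambda_op_in_SStar_fsp)
      fix B :: "'a operation set" assume "B \<in> {V J \<inter> SStar_fsp |J. J \<in> fg_ideals}"
      then obtain J :: "'a fract set" where J: "J \<in> fg_ideals" "B = V J \<inter> SStar_fsp"
        by blast
      have "lambda_op \<F> \<in> B \<longleftrightarrow> \<F> \<in> W J" if F: "\<F> \<in> LS_f" for \<F>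
        using mem_V_fg_iff[OF _ J(1), of "lambda_op \<F>"] lambda_op_in_SStar_fsp[OF F] fg_system_lambda_op[OF F]
          SStar_fsp_subset LS_f_subset_LS J(2) F by (auto simp: W_def)
      then have "{\<F> \<in> topspace zariski_LS_f. lambda_op \<F> \<in> B} = W J \<inter> LS_f"
        unfolding topspace_zariski_LS_f by blast
      then show "openin zariski_LS_f {\<F> \<in> topspace zariski_LS_f. lambda_op \<F> \<in> B}"
        using openin_zariski_LS_f_W J fg_ideals_subset_ideals by auto
    qed
    show "continuous_map (zariski_fsp :: 'a operation topology) zariski_LS_f fg_system"
      unfolding zariski_LS_f_def continuous_map_in_subtopology
    proof
      show "fg_system \<in> topspace zariski_fsp \<rightarrow> (LS_f :: 'a fract set set set)"
        by (simp add: topspace_zariski_fsp SStar_fsp_D(2))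
      show "continuous_map (zariski_fsp :: 'a operation topology) zariski_LS fg_system"
        unfolding zariski_LS_def
      proof (rule continuous_map_generated)
        have "\<Union>{W I |I. I \<in> (ideals :: 'a fract set set)} = LS"
          using topspace_zariski_LS unfolding zariski_LS_def topology_generated_by_topspace .
        then show "fg_system \<in> topspace zariski_fsp \<rightarrow> \<Union>{W I |I. I \<in> (ideals :: 'a fract set set)}"
          by (simp add: topspace_zariski_fsp SStar_fsp_D(2) subsetD[OF LS_f_subset_LS])
        fix B :: "'a fract set set set" assume "B \<in> {W I |I. I \<in> ideals}"
        then obtain I :: "'a fract set" where I: "I \<in> ideals" "B = W I"
          by blast
        show "openin zariski_fsp {s \<in> topspace zariski_fsp. fg_system s \<in> B}"
        proof (cases "I = {0}")
          case True
          then have "B = {}"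
            using I LS_D by (auto simp: W_def)
          then show ?thesis
            by simp
        next
          case False
          have "fg_system s \<in> B \<longleftrightarrow> s \<in> V I" if "s \<in> SStar_fsp" for s
            using mem_V_SStar_fsp_iff[OF that I(1) False] SStar_fsp_D(2)[OF that] LS_f_subset_LS I
            by (auto simp: W_def)
          then have "{s \<in> topspace zariski_fsp. fg_system s \<in> B} = V I \<inter> SStar_fsp"
            unfolding topspace_zariski_fsp by blast
          moreover have "I \<in> Fbar"
            using I False by (intro subsetD[OF ideals_subset_Fbar]) simp
          ultimately show ?thesis
            using openin_zariski_fsp_V by simp
        qed
      qed
    qed
    show "fg_system (lambda_op \<F>) = \<F>" if "\<F> \<in> LS_f" for \<F> :: "'a fract set set"
      using fg_system_lambda_op[OF that] .
    show "lambda_op (fg_system s) = s" if "s \<in> SStar_fsp" for s :: "'a operation"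
      using SStar_fsp_D(3)[OF that] .
  qed
qed

theorem proposition4p3:
  shows
    "((zariski_fsp :: 'a::idom operation topology) =
        topology_generated_by {V J \<inter> SStar_fsp | J. J \<in> fg_ideals} \<and>
      (\<forall>J\<in>(fg_ideals :: 'a fract set set).
         openin zariski_fsp (V J \<inter> SStar_fsp) \<and> compactin zariski_fsp (V J \<inter> SStar_fsp))) \<and>
     retraction_maps (zariski_SStar :: 'a operation topology) zariski_fsp tilde id \<and>
     canonical_Kolmogorov_map (fg_topology_SStar :: 'a operation topology) zariski_fsp tilde \<and>
     (\<forall>st\<in>(Star :: 'a operation set).
        stable_on fractional_ideals st \<and> finite_type_on fractional_ideals st \<longrightarrow>
        (\<exists>!s. s \<in> SStar \<and> stable_on Fbar s \<and> finite_type_on Fbar s \<and>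
              restrict s fractional_ideals = st)) \<and>
     homeomorphic_map (zariski_LS_f :: 'a fract set set topology) zariski_fsp lambda_op"
proof (intro conjI ballI impI)
  show "openin zariski_fsp (V J \<inter> SStar_fsp)" if "J \<in> fg_ideals" for J :: "'a fract set"
    using openin_zariski_fsp_V subsetD[OF fg_ideals_subset_Fbar that] .
qed (fact zariski_fsp_eq retraction_tilde canonical_Kolmogorov_map_tilde homeomorphic_lambda_op
  | simp add: compactin_V unique_semistar_extension)+

end
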